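(* Let $X$ be a separable Banach space, $0<p\le\infty$ and $r\in\mathbb{N}$. Then there exists a constant $c>0$ such that for any interval $I=[a,b)$ and every $f\in L_p(I,X)$ there exists a vector-valued polynomial $P_r\in\mathbb{V}^r_{I,X}$ which satisfies \[ \|f-P_r\|^p_{L_p(I,X)}\le c\,w_r(f,I,h)_p^p\qquad\text{with}\qquad h=\frac{|I|}{2r}. \] In other words, there exist $a_0,a_1,\dots,a_{r-1}\in X$ such that the inequality holds with $P_r(t)=a_0+a_1t+\dots+a_{r-1}t^{r-1}$.
   Context: $I=[a,b)$ is a bounded real interval with $|I|=b-a$. $L_p(I,X)$ is the space of measurable $f:I\to X$ with $\|f\|_{L_p(I,X)}=(\int_I\|f(t)\|_X^p\,dt)^{1/p}<\infty$ if $p<\infty$, and $\|f\|_{L_\infty(I,X)}=\operatorname{ess\,sup}_{t\in I}\|f(t)\|_X<\infty$ if $p=\infty$. $\mathbb{V}^r_{I,X}$ is the space of $X$-valued polynomials of order $r$: functions $P:I\to X$, $P(t)=\sum_{j=0}^{r-1}a_jt^j$ with $a_j\in X$. For $h>0$, $\Delta_h^rf(t)=\sum_{i=0}^r\binom ri(-1)^{r-i}f(t+ih)$ for $t\in I_{rh}=\{t\in I:t+rh\in I\}$. The averaged modulus of smoothness is $w_r(f,I,u)_p=\big(\frac1u\int_0^u\|\Delta_h^rf\|^p_{L_p(I_{rh},X)}\,dh\big)^{1/p}$, $u>0$, for $p<\infty$. For $p=\infty$ the inequality is read without the $p$-th powers and with $w_r(f,I,u)_\infty=\sup_{0<h\le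 u}\|\Delta_h^rf\|_{L_\infty(I_{rh},X)}$. *)

theory Defs
  imports "HOL-Analysis.Analysis" "HOL-Probability.Essential_Supremum"
begin

(* Real powers on [0,\<infinity>]; only used with exponent s > 0. *)
definition ennpowr :: "ennreal \<Rightarrow> real \<Rightarrow> ennreal" where
  "ennpowr x s = (if x = \<infinity> then \<infinity> else ennreal (enn2real x powr s))"

lemma ennpowr_ennreal: "0 \<le> x \<Longrightarrow> ennpowr (ennreal x) s = ennreal (x powr s)"
  by (simp add: ennpowr_def)

(* The (quasi-)norm takes values in [0,\<infinity>], and the exponent p ranges over (0,\<infinity>]. *)
definition Lp_norm :: "ennreal \<Rightarrow> real set \<Rightarrow> (real \<Rightarrow> 'a::real_normed_vector) \<Rightarrow> ennreal" where
  "Lp_norm p S f =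
     (if p = \<infinity> then esssup (lebesgue_on S) (\<lambda>t. ennreal (norm (f t)))
      else ennpowr (\<integral>\<^sup>+ t. ennreal (norm (f t) powr enn2real p) \<partial>lebesgue_on S) (1 / enn2real p))"

(* Only the values on S matter. Lebesgue measurability is strong measurability here, since the
   target is assumed second countable, i.e. separable. *)
definition Lp_space ::
  "ennreal \<Rightarrow> real set \<Rightarrow> (real \<Rightarrow> 'a::{real_normed_vector, second_countable_topology}) set" where
  "Lp_space p S = {f. f \<in> borel_measurable (lebesgue_on S) \<and> Lp_norm p S f < \<infinity>}"

definition vpoly :: "nat \<Rightarrow> real set \<Rightarrow> (real \<Rightarrow> 'a::real_vector) set" where
  "vpoly r S = {P. \<exists>a :: nat \<Rightarrow> 'a. \<forall>t\<in>S. P t = (\<Sum>j<r. t ^ j *\<^sub>R a j)}"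

definition fdiff :: "nat \<Rightarrow> real \<Rightarrow> (real \<Rightarrow> 'a::real_vector) \<Rightarrow> real \<Rightarrow> 'a" where
  "fdiff r h f t = (\<Sum>i\<le>r. (real (r choose i) * (- 1) ^ (r - i)) *\<^sub>R f (t + real i * h))"

definition shrunk :: "real set \<Rightarrow> real \<Rightarrow> real set" where
  "shrunk S s = {t \<in> S. t + s \<in> S}"

definition avg_modulus ::
  "nat \<Rightarrow> (real \<Rightarrow> 'a::real_normed_vector) \<Rightarrow> real set \<Rightarrow> real \<Rightarrow> ennreal \<Rightarrow> ennreal" where
  "avg_modulus r f S u p =
     (if p = \<infinity> then (SUP h\<in>{0<..u}. Lp_norm p (shrunk S (real r * h)) (fdiff r h f))
      else ennpowr
        (inverse (ennreal u) *
          (\<integral>\<^sup>+ h. ennpowr (Lp_norm p (shrunk S (real r * h)) (fdiff r h f)) (enn2real p)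
             \<partial>lebesgue_on {0<..u}))
        (1 / enn2real p))"

end

theory Submission
  imports Defs
begin

text \<open>Djokovic's formula expresses an iterated difference with arbitrary steps by translates of
  \<open>(y, v) \<mapsto> \<Delta>\<^sub>v\<^sup>r f(y)\<close>, so the averaged modulus controls \<open>r\<close>-fold differences
  for every choice of small steps. By induction on \<open>r\<close>, the difference \<open>\<Delta>\<^sub>1 f\<close> is close to a
  polynomial of order \<open>r - 1\<close>; subtracting a polynomial of order \<open>r\<close> from \<open>f\<close> makes \<open>f\<close> almost
  \<open>1\<close>-periodic. For an almost periodic function the identity
  \<open>2 \<Delta>\<^sub>h = \<Delta>\<^bsub>2h\<^esub> - \<Delta>\<^sub>h\<^sup>2\<close>, with \<open>2h\<close> reduced modulo \<open>1\<close>, is a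
  contraction that bounds the differences of order \<open>r - 1\<close> by those of order \<open>r\<close>, and the induction
  hypothesis applies once more. No averaging of values of \<open>f\<close> and no compactness is involved, so this
  works for \<open>p < 1\<close> and for infinite-dimensional targets. The case \<open>p = \<infinity>\<close> follows from
  \<open>p = 1\<close> by averaging \<open>f(t) = \<plusminus>\<Delta>\<^sub>h\<^sup>r f(t) + \<dots>\<close> over \<open>h\<close>.\<close>

section \<open>Iterated differences\<close>

text \<open>Hence the base case takes a value \<open>f y\<close> as its constant, and the
  contraction has to win against the constant of the quasi-triangle inequality. A contraction can
  absorb only finite quantities; this is where the finiteness of the norm of \<open>f\<close>
  enters. Differences look to the right, so the strong form concludes on \<open>{0..<n}\<close> from
  hypotheses on \<open>{0..<n + d}\<close>, with \<open>d\<close> depending on the order but not on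
  \<open>n\<close>. The lost length is recovered for one suitable interval only, in which the
  admissible steps are longer than the missing piece; scaling supplies all other intervals.
  Polynomials live on the whole line until the end, and \<open>f\<close> is replaced by a Borel
  representative on the line, so that translates and maps such as \<open>(y, v)\<close> to
  \<open>f (y + i v)\<close> are defined everywhere and measurable.\<close>

primrec mdiff :: "'b::ab_group_add list \<Rightarrow> ('b \<Rightarrow> 'a::ab_group_add) \<Rightarrow> 'b \<Rightarrow> 'a" where
  "mdiff [] f x = f x"
| "mdiff (h # hs) f x = mdiff hs f (x + h) - mdiff hs f x"

text \<open>These are the offsets at which \<open>mdiff hs f x\<close> samples \<open>f\<close>, one
  for each choice of a subset of the steps. A list keeps multiplicities, so their number is an exact
  power of 2. The group stays general because steps are later taken in the plane as well.\<close>

primrec subset_sums :: "'b::ab_group_add list \<Rightarrow> 'b list" where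
  "subset_sums [] = [0]"
| "subset_sums (h # hs) = map ((+) h) (subset_sums hs) @ subset_sums hs"

lemma length_subset_sums: "length (subset_sums hs) = 2 ^ length hs"
  by (induction hs) auto

lemma subset_sums_bounds:
  fixes hs :: "real list" and s u :: real
  assumes "s \<in> set (subset_sums hs)" "set hs \<subseteq> {0..u}"
  shows "0 \<le> s" "s \<le> real (length hs) * u"
proof -
  have "0 \<le> s \<and> s \<le> real (length hs) * u"
    using assms
  proof (induction hs arbitrary: s)
    case (Cons h hs)
    then show ?case by (fastforce simp: algebra_simps)
  qed simp
  then show "0 \<le> s" "s \<le> real (length hs) * u" by auto
qed

lemma mdiff_diff: "mdiff hs (\<lambda>x. f x - g x) x = mdiff hs f x - mdiff hs g x"
  by (induction hs arbitrary: x) (auto simp: algebra_simps)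

lemma mdiff_shift: "mdiff hs (\<lambda>x. f (x + c)) x = mdiff hs f (x + c)"
  by (induction hs arbitrary: x) (auto simp: algebra_simps)

lemma mdiff_difference: "mdiff hs (\<lambda>x. f (x + c) - f x) x = mdiff (c # hs) f x"
  by (simp add: mdiff_diff mdiff_shift)

lemma mdiff_zero_step: "0 \<in> set hs \<Longrightarrow> mdiff hs f x = 0"
proof (induction hs arbitrary: x)
  case (Cons h hs)
  then show ?case by (cases "h = 0") auto
qed simp

text \<open>Additivity of \<open>L i\<close> turns a step \<open>z\<close> taken before
  \<open>L i\<close> into the step \<open>L i z\<close> taken after it. A planar difference thereby
  becomes a sum of ordinary differences, each of which vanishes once one of its steps is mapped to
  0.\<close>

lemma mdiff_sum_linear:
  fixes f :: "'b::ab_group_add \<Rightarrow> 'a::real_vector" and L :: "'i \<Rightarrow> 'c::ab_group_add \<Rightarrow> 'b"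
  assumes "\<And>i y z. L i (y + z) = L i y + L i z"
  shows "mdiff zs (\<lambda>z. \<Sum>i\<in>I. c i *\<^sub>R f (L i z)) z = (\<Sum>i\<in>I. c i *\<^sub>R mdiff (map (L i) zs) f (L i z))"
  by (induction zs arbitrary: z) (simp_all add: assms sum_subtractf scaleR_diff_right)

lemma mdiff_measurable [measurable]:
  fixes f :: "'b::euclidean_space \<Rightarrow> 'a::{real_normed_vector, second_countable_topology}"
  assumes [measurable]: "f \<in> borel_measurable borel"
  shows "mdiff hs f \<in> borel_measurable borel"
proof (induction hs)
  case Nil
  show ?case using assms by (simp cong: measurable_cong)
next
  case (Cons h hs)
  note [measurable] = Cons
  show ?case by simp
qed

text \<open>The \<open>p\<close>-th power of the quasi-norm on \<open>A\<close>, not the quasi-norm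
  itself: powers are additive over disjoint sets and allow the same estimates below and above
  \<open>p = 1\<close>. General Euclidean domains cover integrals over pairs of a point and a
  step.\<close>

definition pint :: "real \<Rightarrow> 'b::euclidean_space set \<Rightarrow> ('b \<Rightarrow> 'a::real_normed_vector) \<Rightarrow> ennreal" where
  "pint p A f = (\<integral>\<^sup>+ x. ennreal (norm (f x) powr p) * indicator A x \<partial>lborel)"

text \<open>Bounding the sum by twice the larger term gives the factor \<open>2 powr p\<close> for
  every positive \<open>p\<close>, without distinguishing concave from convex powers.\<close>

lemma powr_norm_add_le:
  fixes x y :: "'a::real_normed_vector"
  assumes "0 < p"
  shows "norm (x + y) powr p \<le> 2 powr p * (norm x powr p + norm y powr p)"
proof -
  have "norm (x + y) powr p \<le> (2 * max (norm x) (norm y)) powr p"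
    using norm_triangle_ineq[of x y] assms by (intro powr_mono2) auto
  also have "\<dots> = 2 powr p * max (norm x) (norm y) powr p"
    by (simp add: powr_mult)
  also have "\<dots> \<le> 2 powr p * (norm x powr p + norm y powr p)"
    by (intro mult_left_mono) (auto simp: max_def)
  finally show ?thesis .
qed

lemma powr_norm_diff_le:
  fixes x y :: "'a::real_normed_vector"
  assumes "0 < p"
  shows "norm (x - y) powr p \<le> 2 powr p * (norm x powr p + norm y powr p)"
  using powr_norm_add_le[OF assms, of x "-y"] by simp

lemma powr_norm_sum_le:
  fixes g :: "'i \<Rightarrow> 'a::real_normed_vector"
  assumes "0 < p" "finite I"
  shows "norm (\<Sum>i\<in>I. g i) powr p \<le> (2 powr p) ^ card I * (\<Sum>i\<in>I. norm (g i) powr p)"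
  using assms(2)
proof induction
  case (insert i I)
  have "1 \<le> 2 powr p" using assms(1) by (simp add: ge_one_powr_ge_zero)
  then have one: "1 \<le> (2 powr p) ^ card I" by simp
  have "norm (\<Sum>i\<in>insert i I. g i) powr p \<le> 2 powr p * (norm (g i) powr p + norm (\<Sum>i\<in>I. g i) powr p)"
    using insert powr_norm_add_le[OF assms(1)] by simp
  also have "\<dots> \<le> 2 powr p * ((2 powr p) ^ card I * norm (g i) powr p + (2 powr p) ^ card I * (\<Sum>i\<in>I. norm (g i) powr p))"
    using insert.IH mult_right_mono[OF one, of "norm (g i) powr p"] by (intro mult_left_mono add_mono) auto
  finally show ?case using insert by (simp add: algebra_simps)
qed simp

lemma mdiff_powr_norm_le:
  fixes f :: "'b::ab_group_add \<Rightarrow> 'a::real_normed_vector"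
  assumes "0 < p"
  shows "norm (mdiff hs f x) powr p \<le> (2 powr p) ^ length hs * (\<Sum>s\<leftarrow>subset_sums hs. norm (f (x + s)) powr p)"
proof (induction hs arbitrary: x)
  case (Cons h hs)
  have "norm (mdiff (h # hs) f x) powr p \<le> 2 powr p * (norm (mdiff hs f (x + h)) powr p + norm (mdiff hs f x) powr p)"
    using powr_norm_diff_le[OF assms] by simp
  also have "\<dots> \<le> 2 powr p * ((2 powr p) ^ length hs * (\<Sum>s\<leftarrow>subset_sums hs. norm (f (x + h + s)) powr p)
      + (2 powr p) ^ length hs * (\<Sum>s\<leftarrow>subset_sums hs. norm (f (x + s)) powr p))"
    by (intro mult_left_mono add_mono Cons) auto
  finally show ?case by (simp add: algebra_simps o_def)
qed simp

context
  fixes p :: real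
  assumes p: "0 < p"
begin

lemma pint_mono:
  assumes "A \<subseteq> B"
  shows "pint p A f \<le> pint p B f"
  unfolding pint_def using assms by (intro nn_integral_mono) (auto simp: indicator_def)

lemma pint_translate:
  fixes f :: "'b::euclidean_space \<Rightarrow> 'a::{real_normed_vector, second_countable_topology}"
  assumes [measurable]: "f \<in> borel_measurable borel" "B \<in> sets borel"
    and AB: "\<And>x. x \<in> A \<Longrightarrow> x + c \<in> B"
  shows "pint p A (\<lambda>x. f (x + c)) \<le> pint p B f"
proof -
  have "pint p A (\<lambda>x. f (x + c)) \<le> (\<integral>\<^sup>+ x. ennreal (norm (f (c + x)) powr p) * indicator B (c + x) \<partial>lborel)"
    unfolding pint_def using AB by (intro nn_integral_mono) (auto simp: indicator_def add.commute)
  also have "\<dots> = (\<integral>\<^sup>+ x. ennreal (norm (f x) powr p) * indicator B x \<partial>distr lborel borel ((+) c))"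
    by (subst nn_integral_distr) auto
  also have "\<dots> = pint p B f"
    unfolding pint_def lborel_distr_plus ..
  finally show ?thesis .
qed

lemma pint_le_add:
  fixes f g h :: "'b::euclidean_space \<Rightarrow> 'a::{real_normed_vector, second_countable_topology}"
  assumes [measurable]: "g \<in> borel_measurable borel" "h \<in> borel_measurable borel" "A \<in> sets borel"
    and "0 \<le> c" "0 \<le> d"
    and "\<And>x. x \<in> A \<Longrightarrow> norm (f x) powr p \<le> c * norm (g x) powr p + d * norm (h x) powr p"
  shows "pint p A f \<le> ennreal c * pint p A g + ennreal d * pint p A h"
proof -
  have "pint p A f \<le> (\<integral>\<^sup>+ x. ennreal c * (ennreal (norm (g x) powr p) * indicator A x)
      + ennreal d * (ennreal (norm (h x) powr p) * indicator A x) \<partial>lborel)"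
    unfolding pint_def using assms
    by (intro nn_integral_mono) (auto simp: indicator_def ennreal_mult[symmetric] ennreal_plus[symmetric] simp del: ennreal_plus)
  also have "\<dots> = ennreal c * pint p A g + ennreal d * pint p A h"
    unfolding pint_def by (simp add: nn_integral_add nn_integral_cmult)
  finally show ?thesis .
qed

lemma pint_add_le:
  fixes f g :: "'b::euclidean_space \<Rightarrow> 'a::{real_normed_vector, second_countable_topology}"
  assumes "f \<in> borel_measurable borel" "g \<in> borel_measurable borel" "A \<in> sets borel"
  shows "pint p A (\<lambda>x. f x + g x) \<le> ennreal (2 powr p) * (pint p A f + pint p A g)"
  unfolding distrib_left
  by (rule pint_le_add) (use assms powr_norm_add_le[OF p] in \<open>auto simp flip: distrib_left\<close>)

lemma pint_diff_le:
  fixes f g :: "'b::euclidean_space \<Rightarrow> 'a::{real_normed_vector, second_countable_topology}"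
  assumes "f \<in> borel_measurable borel" "g \<in> borel_measurable borel" "A \<in> sets borel"
  shows "pint p A (\<lambda>x. f x - g x) \<le> ennreal (2 powr p) * (pint p A f + pint p A g)"
  unfolding distrib_left
  by (rule pint_le_add) (use assms powr_norm_diff_le[OF p] in \<open>auto simp flip: distrib_left\<close>)

lemma pint_Un_le:
  fixes f :: "'b::euclidean_space \<Rightarrow> 'a::{real_normed_vector, second_countable_topology}"
  assumes [measurable]: "f \<in> borel_measurable borel" "A \<in> sets borel" "B \<in> sets borel"
  shows "pint p (A \<union> B) f \<le> pint p A f + pint p B f"
proof -
  have "pint p (A \<union> B) f \<le> (\<integral>\<^sup>+ x. ennreal (norm (f x) powr p) * indicator A x
      + ennreal (norm (f x) powr p) * indicator B x \<partial>lborel)"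
    unfolding pint_def by (intro nn_integral_mono) (auto simp: indicator_def)
  also have "\<dots> = pint p A f + pint p B f"
    unfolding pint_def by (simp add: nn_integral_add)
  finally show ?thesis .
qed

text \<open>Every step doubles the number of offsets and costs one factor \<open>2 powr p\<close> in
  the quasi-triangle inequality, hence the base \<open>2 * 2 powr p\<close>. The only geometry to
  check is that all offsets carry \<open>A\<close> into \<open>B\<close>.\<close>

lemma pint_mdiff_le:
  fixes f :: "'b::euclidean_space \<Rightarrow> 'a::{real_normed_vector, second_countable_topology}"
  assumes [measurable]: "f \<in> borel_measurable borel" "A \<in> sets borel" "B \<in> sets borel"
    and AB: "\<And>s x. s \<in> set (subset_sums hs) \<Longrightarrow> x \<in> A \<Longrightarrow> x + s \<in> B"
  shows "pint p A (mdiff hs f) \<le> ennreal ((2 * 2 powr p) ^ length hs) * pint p B f"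
proof -
  let ?K = "(2 powr p) ^ length hs"
  have *: "(\<integral>\<^sup>+ x. ennreal (\<Sum>s\<leftarrow>ss. norm (f (x + s)) powr p) * indicator A x \<partial>lborel)
      \<le> of_nat (length ss) * pint p B f" if "set ss \<subseteq> set (subset_sums hs)" for ss
    using that
  proof (induction ss)
    case (Cons s ss)
    have nn: "0 \<le> (\<Sum>s\<leftarrow>ss. norm (f (x + s)) powr p)" for x
      by (intro sum_list_nonneg) auto
    have [measurable]: "(\<lambda>x. \<Sum>s\<leftarrow>ss. norm (f (x + s)) powr p) \<in> borel_measurable borel"
      by (induction ss) auto
    have "(\<integral>\<^sup>+ x. ennreal (\<Sum>s\<leftarrow>s # ss. norm (f (x + s)) powr p) * indicator A x \<partial>lborel)
      = pint p A (\<lambda>x. f (x + s)) + (\<integral>\<^sup>+ x. ennreal (\<Sum>s\<leftarrow>ss. norm (f (x + s)) powr p) * indicator A x \<partial>lborel)"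
      unfolding pint_def by (simp add: nn ennreal_plus distrib_right nn_integral_add)
    also have "\<dots> \<le> pint p B f + of_nat (length ss) * pint p B f"
      using Cons AB by (intro add_mono pint_translate) auto
    finally show ?case by (simp add: algebra_simps)
  qed simp
  have [measurable]: "(\<lambda>x. \<Sum>s\<leftarrow>ss. norm (f (x + s)) powr p) \<in> borel_measurable borel" for ss
    by (induction ss) auto
  have "pint p A (mdiff hs f) \<le> (\<integral>\<^sup>+ x. ennreal ?K *
      (ennreal (\<Sum>s\<leftarrow>subset_sums hs. norm (f (x + s)) powr p) * indicator A x) \<partial>lborel)"
    unfolding pint_def using mdiff_powr_norm_le[OF p, of hs f]
    by (intro nn_integral_mono) (auto simp: indicator_def simp flip: ennreal_mult' intro: ennreal_leI)
  also have "\<dots> \<le> ennreal ?K * (of_nat (2 ^ length hs) * pint p B f)"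
    using *[of "subset_sums hs"] by (subst nn_integral_cmult) (auto intro!: mult_left_mono simp: length_subset_sums)
  also have "\<dots> = ennreal ((2 * 2 powr p) ^ length hs) * pint p B f"
  proof -
    have "of_nat (2 ^ length hs) = ennreal (2 ^ length hs)"
      by (simp add: ennreal_of_nat_eq_real_of_nat)
    moreover have "ennreal ?K * ennreal (2 ^ length hs) = ennreal ((2 * 2 powr p) ^ length hs)"
      by (subst ennreal_mult[symmetric]) (simp_all add: power_mult_distrib mult.commute)
    ultimately show ?thesis by (simp only: flip: mult.assoc)
  qed
  finally show ?thesis .
qed

end

section \<open>Vector-valued polynomials and Djokovic's formula\<close>

lemma vpoly_sum_monomials: "(\<lambda>t. \<Sum>j<r. t ^ j *\<^sub>R a j) \<in> vpoly r UNIV"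
  unfolding vpoly_def by auto

lemma vpolyE:
  assumes "P \<in> vpoly r UNIV"
  obtains a where "P = (\<lambda>t. \<Sum>j<r. t ^ j *\<^sub>R a j)"
  using assms unfolding vpoly_def by auto

lemma vpoly_0: "P \<in> vpoly 0 UNIV \<longleftrightarrow> P = (\<lambda>_. 0)"
  unfolding vpoly_def by auto

lemma vpoly_zero: "(\<lambda>_. 0) \<in> vpoly r UNIV"
  unfolding vpoly_def by (auto intro!: exI[of _ "\<lambda>_. 0"])

lemma vpoly_add:
  assumes "P \<in> vpoly r UNIV" "Q \<in> vpoly r UNIV"
  shows "(\<lambda>t. P t + Q t) \<in> vpoly r UNIV"
proof -
  obtain a b where "P = (\<lambda>t. \<Sum>j<r. t ^ j *\<^sub>R a j)" "Q = (\<lambda>t. \<Sum>j<r. t ^ j *\<^sub>R b j)"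
    using assms by (elim vpolyE)
  then have "(\<lambda>t. P t + Q t) = (\<lambda>t. \<Sum>j<r. t ^ j *\<^sub>R (a j + b j))"
    by (simp add: scaleR_add_right sum.distrib)
  then show ?thesis using vpoly_sum_monomials by metis
qed

lemma vpoly_scale:
  assumes "P \<in> vpoly r UNIV"
  shows "(\<lambda>t. c *\<^sub>R P t) \<in> vpoly r UNIV"
proof -
  obtain a where "P = (\<lambda>t. \<Sum>j<r. t ^ j *\<^sub>R a j)" using assms by (elim vpolyE)
  then have "(\<lambda>t. c *\<^sub>R P t) = (\<lambda>t. \<Sum>j<r. t ^ j *\<^sub>R (c *\<^sub>R a j))"
    by (simp add: scaleR_sum_right mult.commute)
  then show ?thesis using vpoly_sum_monomials by metis
qed

lemma vpoly_diff:
  assumes "P \<in> vpoly r UNIV" "Q \<in> vpoly r UNIV"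
  shows "(\<lambda>t. P t - Q t) \<in> vpoly r UNIV"
  using vpoly_add[OF assms(1) vpoly_scale[OF assms(2), of "-1"]] by simp

lemma vpoly_sum:
  assumes "\<And>i. i \<in> I \<Longrightarrow> P i \<in> vpoly r UNIV"
  shows "(\<lambda>t. \<Sum>i\<in>I. P i t) \<in> vpoly r UNIV"
  using assms by (induction I rule: infinite_finite_induct) (auto intro: vpoly_add vpoly_zero)

lemma vpoly_mono:
  assumes "P \<in> vpoly r UNIV" "r \<le> s"
  shows "P \<in> vpoly s UNIV"
proof -
  obtain a where "P = (\<lambda>t. \<Sum>j<r. t ^ j *\<^sub>R a j)" using assms by (elim vpolyE)
  moreover have "(\<Sum>j<r. t ^ j *\<^sub>R a j) = (\<Sum>j<s. t ^ j *\<^sub>R (if j < r then a j else 0))" for t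
    using assms(2) by (intro sum.mono_neutral_cong_left) auto
  ultimately show ?thesis using vpoly_sum_monomials[where r = s and a = "\<lambda>j. if j < r then a j else 0"] by simp
qed

lemma vpoly_monomial: "(\<lambda>t. t ^ j *\<^sub>R a) \<in> vpoly (Suc j) UNIV"
proof -
  have "t ^ j *\<^sub>R a = (\<Sum>i<Suc j. t ^ i *\<^sub>R (if i = j then a else 0))" for t :: real
    by (simp add: sum.neutral)
  then show ?thesis using vpoly_sum_monomials[where r = "Suc j" and a = "\<lambda>i. if i = j then a else 0"] by simp
qed

lemma vpoly_times_linear:
  assumes "P \<in> vpoly r UNIV"
  shows "(\<lambda>t. (c + l * t) *\<^sub>R P t) \<in> vpoly (Suc r) UNIV"
proof -
  obtain a where a: "P = (\<lambda>t. \<Sum>j<r. t ^ j *\<^sub>R a j)" using assms by (elim vpolyE)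
  have "(\<lambda>t. (c + l * t) *\<^sub>R P t) = (\<lambda>t. c *\<^sub>R P t + (\<Sum>j<r. t ^ Suc j *\<^sub>R (l *\<^sub>R a j)))"
    by (simp add: a scaleR_sum_right sum.distrib[symmetric] algebra_simps)
  also have "\<dots> \<in> vpoly (Suc r) UNIV"
    by (intro vpoly_add vpoly_scale vpoly_sum vpoly_mono[OF assms] vpoly_mono[OF vpoly_monomial]) auto
  finally show ?thesis .
qed

lemma vpoly_affine:
  assumes "P \<in> vpoly r UNIV"
  shows "(\<lambda>t. P (c + l * t)) \<in> vpoly r UNIV"
proof -
  have mono: "(\<lambda>t. (c + l * t) ^ j *\<^sub>R a) \<in> vpoly (Suc j) UNIV" for j and a :: 'a
  proof (induction j)
    case 0
    then show ?case using vpoly_monomial[of 0 a] by simp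
  next
    case (Suc j)
    then show ?case using vpoly_times_linear[OF Suc, of c l] by (simp add: mult_ac)
  qed
  obtain a where "P = (\<lambda>t. \<Sum>j<r. t ^ j *\<^sub>R a j)" using assms by (elim vpolyE)
  then show ?thesis by (auto intro!: vpoly_sum vpoly_mono[OF mono])
qed

lemma vpoly_difference:
  assumes "P \<in> vpoly (Suc r) UNIV"
  shows "(\<lambda>t. P (t + h) - P t) \<in> vpoly r UNIV"
proof -
  have mono: "(\<lambda>t. (t + h) ^ j *\<^sub>R a - t ^ j *\<^sub>R a) \<in> vpoly j UNIV" for j and a :: 'a
  proof (induction j)
    case 0
    then show ?case by (simp add: vpoly_zero)
  next
    case (Suc j)
    have "(\<lambda>t. (t + h) ^ Suc j *\<^sub>R a - t ^ Suc j *\<^sub>R a) =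
      (\<lambda>t. (h + 1 * t) *\<^sub>R ((t + h) ^ j *\<^sub>R a - t ^ j *\<^sub>R a) + h *\<^sub>R (t ^ j *\<^sub>R a))"
      by (simp add: algebra_simps)
    also have "\<dots> \<in> vpoly (Suc j) UNIV"
      by (intro vpoly_add vpoly_times_linear Suc vpoly_scale vpoly_monomial)
    finally show ?case .
  qed
  obtain a where "P = (\<lambda>t. \<Sum>j<Suc r. t ^ j *\<^sub>R a j)" using assms by (elim vpolyE)
  then have "(\<lambda>t. P (t + h) - P t) = (\<lambda>t. \<Sum>j<Suc r. (t + h) ^ j *\<^sub>R a j - t ^ j *\<^sub>R a j)"
    by (simp add: sum_subtractf)
  also have "\<dots> \<in> vpoly r UNIV" by (intro vpoly_sum vpoly_mono[OF mono]) auto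
  finally show ?thesis .
qed

text \<open>The forward difference of \<open>t ^ Suc r\<close> divided by \<open>Suc r\<close> is
  \<open>t ^ r\<close> plus a polynomial of order \<open>r\<close>. Matching the top coefficient
  therefore leaves a remainder of smaller order, to which the induction applies.\<close>

lemma vpoly_antidifference:
  assumes "P \<in> vpoly r UNIV"
  obtains Q where "Q \<in> vpoly (Suc r) UNIV" "\<And>t. Q (t + 1) - Q t = P t"
proof -
  have "\<exists>Q \<in> vpoly (Suc r) UNIV. \<forall>t. Q (t + 1) - Q t = P t"
    using assms
  proof (induction r arbitrary: P)
    case 0
    then show ?case by (auto simp: vpoly_0 intro!: bexI[of _ "\<lambda>_. 0"] vpoly_zero)
  next
    case (Suc r)
    obtain a where a: "P = (\<lambda>t. \<Sum>j<Suc r. t ^ j *\<^sub>R a j)" using Suc.prems by (elim vpolyE)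
    have mono: "(\<lambda>t. (t + 1) ^ Suc j *\<^sub>R b - t ^ Suc j *\<^sub>R b - real (Suc j) *\<^sub>R t ^ j *\<^sub>R b) \<in> vpoly j UNIV"
      for j and b :: 'a
    proof (induction j)
      case 0
      then show ?case by (simp add: algebra_simps vpoly_zero)
    next
      case (Suc j)
      have "(\<lambda>t. (t + 1) ^ Suc (Suc j) *\<^sub>R b - t ^ Suc (Suc j) *\<^sub>R b - real (Suc (Suc j)) *\<^sub>R t ^ Suc j *\<^sub>R b)
        = (\<lambda>t. (1 + 1 * t) *\<^sub>R ((t + 1) ^ Suc j *\<^sub>R b - t ^ Suc j *\<^sub>R b - real (Suc j) *\<^sub>R t ^ j *\<^sub>R b)
            + real (Suc j) *\<^sub>R t ^ j *\<^sub>R b)"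
        unfolding scaleR_scaleR scaleR_add_left[symmetric] scaleR_diff_left[symmetric]
        by (intro ext arg_cong[where f = "\<lambda>c. c *\<^sub>R b"]) (simp add: algebra_simps)
      also have "\<dots> \<in> vpoly (Suc j) UNIV"
        by (intro vpoly_add vpoly_times_linear Suc vpoly_scale vpoly_monomial)
      finally show ?case .
    qed
    define Q1 where "Q1 t = t ^ Suc r *\<^sub>R (a r /\<^sub>R real (Suc r))" for t
    define R where "R t = Q1 (t + 1) - Q1 t - t ^ r *\<^sub>R a r" for t
    have "R \<in> vpoly r UNIV"
      using mono[of r "a r /\<^sub>R real (Suc r)"] unfolding R_def Q1_def
      by (simp add: mult.left_commute[of "real (Suc r)"] del: power_Suc of_nat_Suc)
    then have "(\<lambda>t. (\<Sum>j<r. t ^ j *\<^sub>R a j) - R t) \<in> vpoly r UNIV"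
      by (intro vpoly_diff vpoly_sum_monomials)
    from Suc.IH[OF this] obtain Q0 where Q0: "Q0 \<in> vpoly (Suc r) UNIV"
      "\<And>t. Q0 (t + 1) - Q0 t = (\<Sum>j<r. t ^ j *\<^sub>R a j) - R t" by auto
    have "(\<lambda>t. Q0 t + Q1 t) \<in> vpoly (Suc (Suc r)) UNIV"
      unfolding Q1_def by (intro vpoly_add vpoly_mono[OF Q0(1)] vpoly_monomial) auto
    moreover have "(Q0 (t + 1) + Q1 (t + 1)) - (Q0 t + Q1 t) = P t" for t
    proof -
      have "(Q0 (t + 1) + Q1 (t + 1)) - (Q0 t + Q1 t) = (Q0 (t + 1) - Q0 t) + (Q1 (t + 1) - Q1 t)" by simp
      also have "\<dots> = P t" unfolding Q0(2) R_def a by simp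
      finally show ?thesis .
    qed
    ultimately show ?case by (intro bexI[of _ "\<lambda>t. Q0 t + Q1 t"]) auto
  qed
  then show ?thesis using that by auto
qed

lemma mdiff_vpoly: "P \<in> vpoly (length hs) UNIV \<Longrightarrow> mdiff hs P x = 0"
proof (induction hs arbitrary: P x)
  case (Cons h hs)
  have "mdiff (h # hs) P x = mdiff hs (\<lambda>t. P (t + h) - P t) x" by (rule mdiff_difference[symmetric])
  also have "\<dots> = 0" using Cons by (intro Cons.IH vpoly_difference) auto
  finally show ?case .
qed (simp add: vpoly_0)

lemma vpoly_continuous_on:
  fixes P :: "real \<Rightarrow> 'a::real_normed_vector"
  assumes "P \<in> vpoly r UNIV"
  shows "continuous_on S P"
proof -
  obtain a where "P = (\<lambda>t. \<Sum>j<r. t ^ j *\<^sub>R a j)" using assms by (elim vpolyE)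
  then show ?thesis by (auto intro!: continuous_intros)
qed

lemma vpoly_measurable:
  fixes P :: "real \<Rightarrow> 'a::{real_normed_vector, second_countable_topology}"
  assumes "P \<in> vpoly r UNIV"
  shows "P \<in> borel_measurable borel"
  using vpoly_continuous_on[OF assms] by (rule borel_measurable_continuous_onI)

lemma pint_vpoly_finite:
  fixes P :: "real \<Rightarrow> 'a::{real_normed_vector, second_countable_topology}"
  assumes "P \<in> vpoly r UNIV" "0 < p"
  shows "pint p {u..<v} P < \<infinity>"
proof -
  have "compact (P ` {u..v})"
    using vpoly_continuous_on[OF assms(1)] by (intro compact_continuous_image) auto
  then obtain B where B: "\<And>t. t \<in> {u..v} \<Longrightarrow> norm (P t) \<le> B"
    using compact_imp_bounded bounded_iff by (metis imageI)
  have "pint p {u..<v} P \<le> (\<integral>\<^sup>+ x. ennreal (B powr p) * indicator {u..<v} x \<partial>lborel)"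
    unfolding pint_def using B assms(2)
    by (intro nn_integral_mono) (auto simp: indicator_def intro!: ennreal_leI powr_mono2)
  also have "\<dots> < \<infinity>" by (cases "u \<le> v") (auto simp: nn_integral_cmult_indicator ennreal_mult_less_top)
  finally show ?thesis .
qed

section \<open>Finite differences, Djokovic's formula and the averaged modulus as a planar
  integral\<close>

lemma fdiff_Suc: "fdiff (Suc r) h f t = fdiff r h f (t + h) - fdiff r h f t"
proof -
  let ?g = "\<lambda>i. f (t + real i * h)"
  let ?c = "\<lambda>r i. real (r choose i) * (- 1) ^ (r - i)"
  \<comment> \<open>Pascal's rule. For \<open>i \<ge> r\<close> the exponent
    \<open>r - Suc i\<close> is truncated to 0, but the binomial coefficient in front of it
    vanishes.\<close>
  have c: "?c (Suc r) (Suc i) = ?c r i - ?c r (Suc i)" for i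
  proof (cases "i < r")
    case True
    then have "r - i = Suc (r - Suc i)" by simp
    then show ?thesis by (simp add: algebra_simps)
  next
    case False
    then show ?thesis by (cases "i = r") (auto simp: binomial_eq_0)
  qed
  have "fdiff (Suc r) h f t = ?c (Suc r) 0 *\<^sub>R ?g 0 + (\<Sum>i\<le>r. ?c (Suc r) (Suc i) *\<^sub>R ?g (Suc i))"
    unfolding fdiff_def by (rule sum.atMost_Suc_shift)
  also have "\<dots> = (\<Sum>i\<le>r. ?c r i *\<^sub>R ?g (Suc i)) - (?c r 0 *\<^sub>R ?g 0 + (\<Sum>i\<le>r. ?c r (Suc i) *\<^sub>R ?g (Suc i)))"
    unfolding c scaleR_diff_left sum_subtractf by simp
  also have "?c r 0 *\<^sub>R ?g 0 + (\<Sum>i\<le>r. ?c r (Suc i) *\<^sub>R ?g (Suc i)) = (\<Sum>i\<le>Suc r. ?c r i *\<^sub>R ?g i)"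
    by (rule sum.atMost_Suc_shift[symmetric])
  also have "\<dots> = fdiff r h f t" unfolding fdiff_def by simp
  also have "(\<Sum>i\<le>r. ?c r i *\<^sub>R ?g (Suc i)) = fdiff r h f (t + h)"
    unfolding fdiff_def by (simp add: algebra_simps)
  finally show ?thesis .
qed

lemma mdiff_replicate: "mdiff (replicate r h) f t = fdiff r h f t"
proof (induction r arbitrary: t)
  case 0
  show ?case by (simp add: fdiff_def)
qed (simp add: fdiff_Suc)

lemma fdiff_vpoly: "P \<in> vpoly r UNIV \<Longrightarrow> fdiff r h P t = 0"
  using mdiff_vpoly[of P "replicate r h" t] by (simp add: mdiff_replicate)

lemma fdiff_diff: "fdiff r h (\<lambda>t. f t - g t) t = fdiff r h f t - fdiff r h g t"
  unfolding mdiff_replicate[symmetric] by (rule mdiff_diff)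

text \<open>The steps of Djokovic's formula: under \<open>(y, v) \<mapsto> y + i v\<close> the step number
  \<open>i - 1\<close> becomes \<open>0\<close>, so applying them to \<open>(y, v) \<mapsto> fdiff r v f y\<close> leaves only the summand \<open>i = 0\<close>.\<close>

definition djokovic_steps :: "real list \<Rightarrow> (real \<times> real) list" where
  "djokovic_steps hs = map (\<lambda>j. (hs ! j, - (hs ! j / real (Suc j)))) [0..<length hs]"

text \<open>The base point \<open>w\<close> of the step coordinate is arbitrary, because the
  surviving summand \<open>i = 0\<close> does not see it. This freedom allows the identity to be
  integrated over \<open>w\<close>.\<close>

lemma djokovic_formula:
  fixes f :: "real \<Rightarrow> 'a::real_vector"
  assumes "r = length hs"
  shows "mdiff (djokovic_steps hs) (\<lambda>(y, v). fdiff r v f y) (x, w) = (- 1) ^ r *\<^sub>R mdiff hs f x"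
proof -
  let ?L = "\<lambda>i (y, v). y + real i * v"
  let ?c = "\<lambda>i. real (r choose i) * (- 1) ^ (r - i)"
  have "mdiff (djokovic_steps hs) (\<lambda>z. \<Sum>i\<le>r. ?c i *\<^sub>R f (?L i z)) (x, w)
      = (\<Sum>i\<le>r. ?c i *\<^sub>R mdiff (map (?L i) (djokovic_steps hs)) f (?L i (x, w)))"
    by (rule mdiff_sum_linear) (auto simp: algebra_simps)
  also have "\<dots> = (\<Sum>i\<le>r. if i = 0 then (- 1) ^ r *\<^sub>R mdiff hs f x else 0)"
  proof (intro sum.cong refl)
    fix i assume i: "i \<in> {..r}"
    show "?c i *\<^sub>R mdiff (map (?L i) (djokovic_steps hs)) f (?L i (x, w)) =
      (if i = 0 then (- 1) ^ r *\<^sub>R mdiff hs f x else 0)"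
    proof (cases "i = 0")
      case True
      have "map (?L 0) (djokovic_steps hs) = hs"
        unfolding djokovic_steps_def by (simp add: o_def map_nth)
      then show ?thesis using True by simp
    next
      case False
      then have "i - 1 < length hs" "Suc (i - 1) = i" using i assms by auto
      then have "0 \<in> set (map (?L i) (djokovic_steps hs))"
        using False unfolding djokovic_steps_def by (auto intro!: image_eqI[of _ _ "i - 1"])
      then show ?thesis using False by (simp only: mdiff_zero_step) simp
    qed
  qed
  also have "\<dots> = (- 1) ^ r *\<^sub>R mdiff hs f x" by simp
  finally show ?thesis by (simp add: fdiff_def case_prod_unfold)
qed

lemma djokovic_steps_subset_sums:
  assumes "set hs \<subseteq> {0..1}" "s \<in> set (subset_sums (djokovic_steps hs))"
  shows "fst s \<in> {0..real (length hs)}" "snd s \<in> {- real (length hs)..0}"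
proof -
  have *: "0 \<le> fst s \<and> fst s \<le> real (length zs) \<and> - real (length zs) \<le> snd s \<and> snd s \<le> 0"
    if "set zs \<subseteq> {0..1} \<times> {-1..0}" "s \<in> set (subset_sums zs)" for zs and s :: "real \<times> real"
    using that
  proof (induction zs arbitrary: s)
    case (Cons z zs)
    have z: "0 \<le> fst z" "fst z \<le> 1" "-1 \<le> snd z" "snd z \<le> 0" using Cons.prems(1) by (auto simp: mem_Times_iff)
    consider s' where "s' \<in> set (subset_sums zs)" "s = z + s'" | "s \<in> set (subset_sums zs)"
      using Cons.prems(2) by auto
    then show ?case
    proof cases
      case 1
      then show ?thesis using Cons.IH[of s'] Cons.prems(1) z by simp
    next
      case 2
      then show ?thesis using Cons.IH[of s] Cons.prems(1) z by simp
    qed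
  qed simp
  have "(hs ! j, - (hs ! j / real (Suc j))) \<in> {0..1} \<times> {-1..0}" if "j < length hs" for j
  proof -
    have "hs ! j \<in> {0..1}" using assms(1) that by (meson nth_mem subsetD)
    then show ?thesis by (simp add: divide_le_eq)
  qed
  then have "set (djokovic_steps hs) \<subseteq> {0..1} \<times> {-1..0}"
    unfolding djokovic_steps_def by auto
  from *[OF this assms(2)] show "fst s \<in> {0..real (length hs)}" "snd s \<in> {- real (length hs)..0}"
    by (auto simp: djokovic_steps_def)
qed

text \<open>The slice at a step \<open>v\<close> in (0, u] is
  \<open>shrunk {a..<b} (real r * v)\<close>. Averaging over steps and integrating over points merge
  into one planar integral, which can be translated in both variables at once.\<close>

definition modulus_domain :: "nat \<Rightarrow> real \<Rightarrow> real \<Rightarrow> real \<Rightarrow> (real \<times> real) set" where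
  "modulus_domain r a b u = {(y, v). 0 < v \<and> v \<le> u \<and> a \<le> y \<and> y + real r * v < b}"

lemma modulus_domain_sets [measurable]: "modulus_domain r a b u \<in> sets borel"
proof -
  have "modulus_domain r a b u = {z \<in> space borel. 0 < snd z \<and> snd z \<le> u \<and> a \<le> fst z \<and> fst z + real r * snd z < b}"
    unfolding modulus_domain_def by auto
  also have "\<dots> \<in> sets borel" unfolding borel_prod[symmetric] by measurable
  finally show ?thesis .
qed

lemma fdiff_measurable_pair:
  fixes f :: "real \<Rightarrow> 'a::{real_normed_vector, second_countable_topology}"
  assumes [measurable]: "f \<in> borel_measurable borel"
  shows "(\<lambda>(y, v). fdiff r v f y) \<in> borel_measurable borel"
  unfolding fdiff_def case_prod_beta borel_prod[symmetric] by measurable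

lemma fdiff_measurable:
  fixes f :: "real \<Rightarrow> 'a::{real_normed_vector, second_countable_topology}"
  assumes [measurable]: "f \<in> borel_measurable borel"
  shows "fdiff r h f \<in> borel_measurable borel"
  unfolding fdiff_def by measurable

lemma pint_fst_times:
  fixes f :: "real \<Rightarrow> 'a::{real_normed_vector, second_countable_topology}"
  assumes [measurable]: "f \<in> borel_measurable borel" "A \<in> sets borel" "B \<in> sets borel"
  shows "pint p (A \<times> B) (\<lambda>z. f (fst z)) = pint p A f * emeasure lborel B"
proof -
  have "pint p (A \<times> B) (\<lambda>z. f (fst z)) =
    (\<integral>\<^sup>+ z. ennreal (norm (f (fst z)) powr p) * indicator A (fst z) * indicator B (snd z) \<partial>(lborel \<Otimes>\<^sub>M lborel))"
    unfolding pint_def lborel_prod by (intro nn_integral_cong) (auto simp: indicator_def)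
  also have "\<dots> = (\<integral>\<^sup>+ x. \<integral>\<^sup>+ y. ennreal (norm (f x) powr p) * indicator A x * indicator B y \<partial>lborel \<partial>lborel)"
    by (subst lborel.nn_integral_fst[symmetric]) auto
  also have "\<dots> = pint p A f * emeasure lborel B"
    unfolding pint_def by (simp add: nn_integral_cmult nn_integral_multc)
  finally show ?thesis .
qed

text \<open>Djokovic's planar steps raise \<open>y\<close> by at most \<open>r\<close> and lower
  \<open>v\<close> by at most \<open>r\<close>. Starting with \<open>v\<close> in (r, r + 1] keeps
  \<open>v\<close> in (0, r + 1], and \<open>y + r v\<close> then stays below
  \<open>M + r + r (r + 1)\<close>; the two size conditions express exactly this.\<close>

lemma strong_le_averaged_modulus:
  fixes f :: "real \<Rightarrow> 'a::{real_normed_vector, second_countable_topology}"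
  assumes p: "0 < p" and f [measurable]: "f \<in> borel_measurable borel"
    and hs: "length hs = r" "set hs \<subseteq> {0..1}"
    and "M + real r + real r * (real r + 1) \<le> m" "real r + 1 \<le> u"
  shows "pint p {0..<M} (mdiff hs f) \<le>
    ennreal ((2 * 2 powr p) ^ r) * pint p (modulus_domain r 0 m u) (\<lambda>(y, v). fdiff r v f y)"
proof -
  let ?G = "\<lambda>(y, v). fdiff r v f y"
  let ?A = "{0..<M} \<times> {real r<..real r + 1}"
  have l: "length (djokovic_steps hs) = r" using hs by (simp add: djokovic_steps_def)
  have A: "?A \<in> sets borel" unfolding borel_prod[symmetric] by (intro pair_measureI) auto
  \<comment> \<open>The added range of \<open>v\<close> has length 1, so the extra variable does not
    change the integral.\<close>
  have "pint p {0..<M} (mdiff hs f) = pint p ?A (\<lambda>z. mdiff hs f (fst z))"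
    by (subst pint_fst_times) (auto simp: mdiff_measurable)
  also have "\<dots> = pint p ?A (mdiff (djokovic_steps hs) ?G)"
    using djokovic_formula[OF hs(1)[symmetric], of f]
    by (auto simp: pint_def case_prod_beta intro!: nn_integral_cong)
  also have "\<dots> \<le> ennreal ((2 * 2 powr p) ^ r) * pint p (modulus_domain r 0 m u) ?G"
  proof (rule pint_mdiff_le[OF p, where hs = "djokovic_steps hs", unfolded l])
    fix s x assume s: "s \<in> set (subset_sums (djokovic_steps hs))" and x: "x \<in> ?A"
    note b = djokovic_steps_subset_sums[OF hs(2) s]
    have "real r * snd (x + s) \<le> real r * (real r + 1)"
      using b x by (intro mult_left_mono) (auto simp: case_prod_beta)
    then have "x + s \<in> modulus_domain r 0 m u"
      using b x assms hs unfolding modulus_domain_def by (auto simp: case_prod_beta)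
    then show "x + s \<in> modulus_domain r 0 m u" .
  qed (use A fdiff_measurable_pair[OF f] in auto)
  finally show ?thesis .
qed

section \<open>The theorem for strong moduli\<close>

text \<open>The crude factor \<open>2 powr p\<close> would cancel the gain from the 2 on the left of
  the hypothesis. Comparing \<open>norm b\<close> with half of \<open>norm a\<close> moves the loss
  to \<open>b\<close>, and \<open>a\<close> keeps a factor below 1 for every positive
  \<open>p\<close>.\<close>

lemma powr_norm_half_le:
  fixes a b u :: "'a::real_normed_vector"
  assumes "0 < p" and u: "2 *\<^sub>R u = a + b"
  shows "norm u powr p \<le> (3/4) powr p * norm a powr p + (3/2) powr p * norm b powr p"
proof -
  have n: "2 * norm u \<le> norm a + norm b"
    using norm_triangle_ineq[of a b] unfolding u[symmetric] by simp
  show ?thesis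
  proof (cases "norm b \<le> norm a / 2")
    case True
    then have "norm u powr p \<le> (3/4 * norm a) powr p" using n assms(1) by (intro powr_mono2) auto
    also have "\<dots> = (3/4) powr p * norm a powr p" by (rule powr_mult)
    finally show ?thesis by (smt (verit) mult_nonneg_nonneg powr_ge_zero)
  next
    case False
    then have "norm u powr p \<le> (3/2 * norm b) powr p" using n assms(1) by (intro powr_mono2) auto
    also have "\<dots> = (3/2) powr p * norm b powr p" by (rule powr_mult)
    finally show ?thesis by (smt (verit) mult_nonneg_nonneg powr_ge_zero)
  qed
qed

text \<open>The supremum \<open>s\<close> of \<open>A\<close> over \<open>S\<close> satisfies
  \<open>s \<le> \<theta> * s + B\<close>, and the a priori bound \<open>M\<close> makes
  \<open>s\<close> finite, so that \<open>\<theta> * s\<close> can be absorbed. Passing to the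
  supremum avoids following the chain of successive \<open>h'\<close>.\<close>

lemma bounded_contraction_bound:
  fixes A :: "'h \<Rightarrow> ennreal" and \<theta> :: real
  assumes step: "\<And>h. h \<in> S \<Longrightarrow> \<exists>h'\<in>S. A h \<le> ennreal \<theta> * A h' + B"
    and bound: "\<And>h. h \<in> S \<Longrightarrow> A h \<le> M" "M < \<infinity>"
    and \<theta>: "0 \<le> \<theta>" "\<theta> < 1" and h: "h \<in> S"
  shows "A h \<le> ennreal (1 / (1 - \<theta>)) * B"
proof (cases "B = \<infinity>")
  case True
  then show ?thesis using \<theta> by (simp add: ennreal_mult_top)
next
  case False
  define s where "s = (SUP h\<in>S. A h)"
  have "s \<le> M" unfolding s_def using bound(1) by (rule SUP_least)
  then have "s < \<infinity>" using bound(2) by (rule le_less_trans)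
  then obtain s' where s': "s = ennreal s'" "0 \<le> s'" by (cases s) auto
  obtain b where b: "B = ennreal b" "0 \<le> b" using False by (cases B) auto
  have "s \<le> ennreal \<theta> * s + B"
    unfolding s_def
  proof (rule SUP_least)
    fix h assume "h \<in> S"
    then obtain h' where h': "h' \<in> S" "A h \<le> ennreal \<theta> * A h' + B" using step by blast
    note h'(2)
    also have "ennreal \<theta> * A h' + B \<le> ennreal \<theta> * (SUP h\<in>S. A h) + B"
      using h'(1) by (intro add_mono mult_left_mono SUP_upper) auto
    finally show "A h \<le> ennreal \<theta> * (SUP h\<in>S. A h) + B" .
  qed
  then have "s' \<le> \<theta> * s' + b"
    unfolding s' b using s' b \<theta> by (simp flip: ennreal_mult ennreal_plus)
  then have "s' \<le> 1 / (1 - \<theta>) * b" using \<theta> by (simp add: field_simps)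
  then have "s \<le> ennreal (1 / (1 - \<theta>)) * B"
    unfolding s' b using \<theta> b by (simp flip: ennreal_mult)
  moreover have "A h \<le> s" unfolding s_def using h by (rule SUP_upper)
  ultimately show ?thesis by simp
qed

text \<open>Writing \<open>2 \<Delta>\<^sub>h = \<Delta>\<^bsub>2h\<^esub> - \<Delta>\<^sub>h\<^sup>2\<close> and reducing \<open>2h\<close> modulo the
  almost-period \<open>1\<close> gains a factor smaller than \<open>1\<close> in front of the differences of lower order;
  this is the step that also works for \<open>p < 1\<close>.\<close>

lemma almost_periodic_lower_difference:
  fixes f :: "real \<Rightarrow> 'a::{real_normed_vector, second_countable_topology}" and L :: real
  assumes p: "0 < p" and f [measurable]: "f \<in> borel_measurable borel"
    and fin: "pint p {0..<L + 1 + real (length t)} f < \<infinity>"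
    and t: "set t \<subseteq> {0..1}"
    and high: "\<And>h. h \<in> {0..1} \<Longrightarrow> pint p {0..<L} (mdiff (h # h # t) f) \<le> \<epsilon>"
    and per: "pint p {0..<L + 1 + real (length t)} (\<lambda>x. f (x + 1) - f x) \<le> \<epsilon>"
    and h: "h \<in> {0..1}"
  shows "pint p {0..<L} (mdiff (h # t) f) \<le>
    ennreal (1 / (1 - (3/4) powr p) * (3/2) powr p * 2 powr p * (1 + (2 * 2 powr p) ^ length t)) * \<epsilon>"
proof -
  define A where "A h = pint p {0..<L} (mdiff (h # t) f)" for h
  define D where "D = (2 * 2 powr p) ^ length t"
  define g where "g x = f (x + 1) - f x" for x
  let ?\<theta> = "(3/4) powr p" and ?\<kappa> = "(3/2) powr p"
  have [measurable]: "g \<in> borel_measurable borel" unfolding g_def by measurable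
  have D: "0 \<le> D" unfolding D_def by simp
  have step: "\<exists>h'\<in>{0..1}. A h \<le> ennreal ?\<theta> * A h' + ennreal (?\<kappa> * (2 powr p * (1 + D))) * \<epsilon>"
    if h: "h \<in> {0..1}" for h
  proof -
    define m where "m = mdiff t f"
    have [measurable]: "m \<in> borel_measurable borel" unfolding m_def by (rule mdiff_measurable[OF f])
    define a where "a = (if h \<le> 1/2 then 2 * h else 2 * h - 1)"
    \<comment> \<open>\<open>b\<close> collects both errors: the second difference and, when
      \<open>2 * h\<close> exceeds 1, the defect of periodicity at the point shifted by
      \<open>a\<close>.\<close>
    define b where "b x = (if h \<le> 1/2 then 0 else mdiff t g (x + a)) - mdiff (h # h # t) f x" for x
    have [measurable]: "b \<in> borel_measurable borel" unfolding b_def by measurable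
    have a: "a \<in> {0..1}" using h unfolding a_def by auto
    have id: "2 *\<^sub>R mdiff (h # t) f x = mdiff (a # t) f x + b x" for x
    proof -
      have "mdiff t g (x + a) = m (x + a + 1) - m (x + a)"
        unfolding g_def m_def mdiff_difference by simp
      moreover have "m (x + a + 1) = m (x + h + h)" if "\<not> h \<le> 1/2"
        using that unfolding a_def by (intro arg_cong[where f = m]) simp
      moreover have "m (x + a) = m (x + h + h)" if "h \<le> 1/2"
        using that unfolding a_def by (intro arg_cong[where f = m]) simp
      ultimately show ?thesis
        unfolding b_def by (simp add: m_def[symmetric] scaleR_2 del: mult_2 mult_2_right)
    qed
    have "A h \<le> ennreal ?\<theta> * A a + ennreal ?\<kappa> * pint p {0..<L} b"
      unfolding A_def by (rule pint_le_add[OF p]) (use powr_norm_half_le[OF p id] in auto)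
    also have "pint p {0..<L} b \<le> ennreal (2 powr p) * (ennreal D * \<epsilon> + \<epsilon>)"
    proof -
      have "pint p {0..<L} (\<lambda>x. if h \<le> 1/2 then 0 else mdiff t g (x + a)) \<le> ennreal D * \<epsilon>"
      proof (cases "h \<le> 1/2")
        case True
        then show ?thesis by (simp add: pint_def p)
      next
        case False
        have "pint p {0..<L} (\<lambda>x. mdiff t g (x + a)) \<le> pint p {0..<L + 1} (mdiff t g)"
          using a p by (intro pint_translate) auto
        also have "\<dots> \<le> ennreal D * pint p {0..<L + 1 + real (length t)} g"
          unfolding D_def using subset_sums_bounds[OF _ t] by (intro pint_mdiff_le p) force+
        also have "\<dots> \<le> ennreal D * \<epsilon>" using per unfolding g_def by (intro mult_left_mono) auto
        finally show ?thesis using False by simp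
      qed
      moreover have "pint p {0..<L} b \<le> ennreal (2 powr p) *
        (pint p {0..<L} (\<lambda>x. if h \<le> 1/2 then 0 else mdiff t g (x + a)) + pint p {0..<L} (mdiff (h # h # t) f))"
        unfolding b_def by (intro pint_diff_le p) auto
      ultimately show ?thesis using high[OF h] by (meson add_mono mult_left_mono order_trans zero_le)
    qed
    also have "ennreal (2 powr p) * (ennreal D * \<epsilon> + \<epsilon>) = ennreal (2 powr p * (1 + D)) * \<epsilon>"
      using D by (simp add: ennreal_mult ennreal_plus algebra_simps)
    finally have "A h \<le> ennreal ?\<theta> * A a + ennreal ?\<kappa> * (ennreal (2 powr p * (1 + D)) * \<epsilon>)"
      by (simp add: mult_left_mono)
    moreover have "ennreal ?\<kappa> * (ennreal (2 powr p * (1 + D)) * \<epsilon>) = ennreal (?\<kappa> * (2 powr p * (1 + D))) * \<epsilon>"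
      using D by (simp add: ennreal_mult mult.assoc)
    ultimately show ?thesis using a by metis
  qed
  \<comment> \<open>Only the finiteness of this bound matters; its size does not reach the
    conclusion.\<close>
  have bound: "A h \<le> ennreal ((2 * 2 powr p) ^ length (h # t)) * pint p {0..<L + 1 + real (length t)} f"
    if "h \<in> {0..1}" for h
    unfolding A_def using subset_sums_bounds[of _ "h # t" 1] t that
    by (intro pint_mdiff_le p) (force simp del: subset_sums.simps)+
  have "A h \<le> ennreal (1 / (1 - ?\<theta>)) * (ennreal (?\<kappa> * (2 powr p * (1 + D))) * \<epsilon>)"
  proof (rule bounded_contraction_bound[OF step _ _ _ _ h])
    show "ennreal ((2 * 2 powr p) ^ Suc (length t)) * pint p {0..<L + 1 + real (length t)} f < \<infinity>"
      using fin by (auto simp: ennreal_mult_less_top)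
    show "?\<theta> < 1" using p powr_less_mono2[of p "3/4" 1] by simp
  qed (use bound in auto)
  also have "\<dots> = ennreal (1 / (1 - ?\<theta>) * ?\<kappa> * 2 powr p * (1 + D)) * \<epsilon>"
  proof -
    have "?\<theta> < 1" using p powr_less_mono2[of p "3/4" 1] by simp
    then have "0 \<le> 1 / (1 - ?\<theta>)" "0 \<le> ?\<kappa> * (2 powr p * (1 + D))" using D by auto
    then have "ennreal (1 / (1 - ?\<theta>)) * ennreal (?\<kappa> * (2 powr p * (1 + D))) =
      ennreal (1 / (1 - ?\<theta>) * ?\<kappa> * 2 powr p * (1 + D))"
      by (simp only: mult.assoc flip: ennreal_mult)
    then show ?thesis by (metis mult.assoc)
  qed
  finally show ?thesis unfolding A_def D_def .
qed

section \<open>Approximation by a constant from first differences\<close>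

lemma exists_le_average:
  fixes I :: "'b \<Rightarrow> ennreal"
  assumes [measurable]: "I \<in> borel_measurable M" "A \<in> sets M"
    and A: "0 < emeasure M A" "emeasure M A < \<infinity>"
    and le: "(\<integral>\<^sup>+ y. I y * indicator A y \<partial>M) \<le> c * emeasure M A"
  shows "\<exists>y\<in>A. I y \<le> c"
proof (rule ccontr)
  assume "\<not> ?thesis"
  then have gt: "c < I y" if "y \<in> A" for y using that by (auto simp: not_le)
  have "A \<noteq> {}" using A by auto
  then have c: "c < \<infinity>" using gt by (metis ex_in_conv infinity_ennreal_def order_less_le_trans top_greatest)
  \<comment> \<open>Writing \<open>I\<close> as \<open>c\<close> plus the excess
    \<open>I - c\<close> avoids subtracting integrals that might be infinite. The excess has
    integral 0, although it is positive on all of \<open>A\<close>.\<close>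
  have "c * emeasure M A + (\<integral>\<^sup>+ y. (I y - c) * indicator A y \<partial>M) = (\<integral>\<^sup>+ y. c * indicator A y + (I y - c) * indicator A y \<partial>M)"
    by (simp add: nn_integral_add nn_integral_cmult)
  also have "\<dots> = (\<integral>\<^sup>+ y. I y * indicator A y \<partial>M)"
  proof (intro nn_integral_cong)
    fix y
    show "c * indicator A y + (I y - c) * indicator A y = I y * indicator A y"
      using gt[of y] c by (cases "y \<in> A") (auto simp: diff_add_cancel_ennreal add.commute less_imp_le)
  qed
  finally have "c * emeasure M A + (\<integral>\<^sup>+ y. (I y - c) * indicator A y \<partial>M) \<le> c * emeasure M A + 0"
    using le by simp
  moreover have "c * emeasure M A \<noteq> \<infinity>" using c A(2) by (simp add: ennreal_mult_eq_top_iff less_top)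
  ultimately have "(\<integral>\<^sup>+ y. (I y - c) * indicator A y \<partial>M) = 0"
    using ennreal_add_left_cancel_le by (metis infinity_ennreal_def le_zero_eq)
  then have "AE y in M. (I y - c) * indicator A y = 0"
    by (subst (asm) nn_integral_0_iff_AE) auto
  then have "AE y in M. y \<notin> A"
  proof (rule eventually_mono)
    fix y assume 0: "(I y - c) * indicator A y = 0"
    show "y \<notin> A"
    proof
      assume "y \<in> A"
      then show False using 0 gt[of y] by (auto dest!: ennreal_minus_eq_0)
    qed
  qed
  then have "emeasure M A = 0" using AE_iff_null_sets[of A M] by auto
  then show False using A by simp
qed


text \<open>The constant is a value \<open>f y\<close>, found by averaging the error over
  \<open>y\<close> in [1/2, 1). The substitution \<open>y = x + h\<close> turns the double integral
  into first differences with steps in [0, 1], of total at most \<open>\<epsilon>\<close>; the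
  factor 2 is the reciprocal length of the range of \<open>y\<close>.\<close>

lemma half_interval_near_constant:
  fixes f :: "real \<Rightarrow> 'a::{real_normed_vector, second_countable_topology}"
  assumes p: "0 < p" and f [measurable]: "f \<in> borel_measurable borel"
    and le: "\<And>h. h \<in> {0..1} \<Longrightarrow> pint p {0..<1/2} (\<lambda>x. f (x + h) - f x) \<le> \<epsilon>"
  shows "\<exists>c. pint p {0..<1/2} (\<lambda>x. f x - c) \<le> 2 * \<epsilon>"
proof -
  let ?F = "\<lambda>y x. ennreal (norm (f x - f y) powr p)"
  let ?A = "indicator {0..<1/2 :: real} :: real \<Rightarrow> ennreal" and ?B = "indicator {1/2..<1 :: real} :: real \<Rightarrow> ennreal"
  have "(\<integral>\<^sup>+ y. pint p {0..<1/2} (\<lambda>x. f x - f y) * ?B y \<partial>lborel) =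
      (\<integral>\<^sup>+ y. \<integral>\<^sup>+ x. ?F y x * ?A x * ?B y \<partial>lborel \<partial>lborel)"
    unfolding pint_def by (simp add: nn_integral_multc)
  also have "\<dots> = (\<integral>\<^sup>+ x. \<integral>\<^sup>+ y. ?F y x * ?A x * ?B y \<partial>lborel \<partial>lborel)"
    by (rule lborel_pair.Fubini') measurable
  also have "\<dots> = (\<integral>\<^sup>+ x. \<integral>\<^sup>+ h. ?F (x + h) x * ?A x * ?B (x + h) \<partial>lborel \<partial>lborel)"
  proof (rule nn_integral_cong)
    fix x :: real
    show "(\<integral>\<^sup>+ y. ?F y x * ?A x * ?B y \<partial>lborel) = (\<integral>\<^sup>+ h. ?F (x + h) x * ?A x * ?B (x + h) \<partial>lborel)"
      using nn_integral_real_affine[of "\<lambda>y. ?F y x * ?A x * ?B y" 1 x] by simp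
  qed
  also have "\<dots> = (\<integral>\<^sup>+ h. \<integral>\<^sup>+ x. ?F (x + h) x * ?A x * ?B (x + h) \<partial>lborel \<partial>lborel)"
    by (rule lborel_pair.Fubini') measurable
  also have "\<dots> \<le> (\<integral>\<^sup>+ h. \<epsilon> * indicator {0..1::real} h \<partial>lborel)"
  proof (intro nn_integral_mono)
    fix h :: real
    show "(\<integral>\<^sup>+ x. ?F (x + h) x * ?A x * ?B (x + h) \<partial>lborel) \<le> \<epsilon> * indicator {0..1} h"
    proof (cases "h \<in> {0..1}")
      case True
      have "(\<integral>\<^sup>+ x. ?F (x + h) x * ?A x * ?B (x + h) \<partial>lborel) \<le> pint p {0..<1/2} (\<lambda>x. f (x + h) - f x)"
        unfolding pint_def by (intro nn_integral_mono) (auto simp: indicator_def norm_minus_commute)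
      then show ?thesis using le[OF True] True by simp
    next
      case False
      then have 0: "?F (x + h) x * ?A x * ?B (x + h) = 0" for x by (auto simp: indicator_def)
      show ?thesis by (simp only: 0) simp
    qed
  qed
  also have "\<dots> = \<epsilon> * (ennreal 2 * ennreal (1/2))"
    by (subst ennreal_mult[symmetric]) (simp_all add: nn_integral_cmult)
  also have "\<dots> = (2 * \<epsilon>) * emeasure lborel {1/2..<1 :: real}"
    by (simp add: mult_ac)
  finally have "(\<integral>\<^sup>+ y. pint p {0..<1/2} (\<lambda>x. f x - f y) * ?B y \<partial>lborel) \<le> (2 * \<epsilon>) * emeasure lborel {1/2..<1 :: real}" .
  moreover have "(\<lambda>y. pint p {0..<1/2} (\<lambda>x. f x - f y)) \<in> borel_measurable lborel"
    unfolding pint_def by measurable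
  moreover have "emeasure lborel {1/2..<1 :: real} = ennreal (1/2)"
    by (subst emeasure_lborel_Ico) auto
  then have "0 < emeasure lborel {1/2..<1 :: real}" "emeasure lborel {1/2..<1 :: real} < \<infinity>"
    using ennreal_lessI[of "1/2" 0] by (simp_all only: ennreal_0 ennreal_less_top infinity_ennreal_def)
  moreover have "{1/2..<1 :: real} \<in> sets lborel" by simp
  ultimately have "\<exists>y\<in>{1/2..<1}. pint p {0..<1/2} (\<lambda>x. f x - f y) \<le> 2 * \<epsilon>"
    using exists_le_average by blast
  then show ?thesis by blast
qed

text \<open>Each extension by 1/2 replaces the factor \<open>D\<close> by
  \<open>D + 2 powr p * (1 + D)\<close>, which multiplies \<open>D + 1\<close> by
  \<open>1 + 2 powr p\<close>. Starting from \<open>D = 2\<close> yields the closed form.\<close>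

lemma near_constant_propagates:
  fixes f :: "real \<Rightarrow> 'a::{real_normed_vector, second_countable_topology}"
  assumes p: "0 < p" and f [measurable]: "f \<in> borel_measurable borel"
    and start: "pint p {0..<1/2} (\<lambda>x. f x - c) \<le> 2 * \<epsilon>"
    and le: "pint p {0..<real (k + 1) / 2} (\<lambda>x. f (x + 1/2) - f x) \<le> \<epsilon>"
  shows "pint p {0..<real (k + 1) / 2} (\<lambda>x. f x - c) \<le> ennreal ((1 + 2 powr p) ^ k * 3 - 1) * \<epsilon>"
  using le
proof (induction k)
  case 0
  show ?case using start by simp
next
  case (Suc k)
  define D where "D = (1 + 2 powr p) ^ k * 3 - 1"
  have "1 \<le> (1 + 2 powr p) ^ k" by (rule one_le_power) simp
  then have D: "0 \<le> D" unfolding D_def by linarith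
  let ?J = "{0..<real (k + 1) / 2}"
  have sub: "pint p ?J (\<lambda>x. f (x + 1/2) - f x) \<le> \<epsilon>"
    using Suc.prems by (rule order_trans[rotated]) (auto intro!: pint_mono p)
  note IH = Suc.IH[OF sub, folded D_def]
  have "{0..<real (Suc k + 1) / 2} = ?J \<union> {1/2..<real (Suc k + 1) / 2}" by (auto simp: field_simps)
  then have "pint p {0..<real (Suc k + 1) / 2} (\<lambda>x. f x - c) \<le>
      pint p ?J (\<lambda>x. f x - c) + pint p {1/2..<real (Suc k + 1) / 2} (\<lambda>x. f x - c)"
    using pint_Un_le[OF p, of "\<lambda>x. f x - c" ?J "{1/2..<real (Suc k + 1) / 2}"] by simp
  also have "pint p {1/2..<real (Suc k + 1) / 2} (\<lambda>x. f x - c) =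
      pint p {1/2..<real (Suc k + 1) / 2} (\<lambda>x. f ((x + - (1/2)) + 1/2) - c)" by simp
  also have "\<dots> \<le> pint p ?J (\<lambda>x. f (x + 1/2) - c)"
    by (intro pint_translate[OF p, where f = "\<lambda>x. f (x + 1/2) - c"]) (auto simp: field_simps)
  also have "\<dots> = pint p ?J (\<lambda>x. (f (x + 1/2) - f x) + (f x - c))" by simp
  also have "\<dots> \<le> ennreal (2 powr p) * (pint p ?J (\<lambda>x. f (x + 1/2) - f x) + pint p ?J (\<lambda>x. f x - c))"
    by (intro pint_add_le p) auto
  also have "\<dots> \<le> ennreal (2 powr p) * (\<epsilon> + ennreal D * \<epsilon>)"
    using sub IH by (intro mult_left_mono add_mono) auto
  also have "pint p ?J (\<lambda>x. f x - c) \<le> ennreal D * \<epsilon>" by (rule IH)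
  finally have "pint p {0..<real (Suc k + 1) / 2} (\<lambda>x. f x - c) \<le>
    ennreal D * \<epsilon> + ennreal (2 powr p) * (\<epsilon> + ennreal D * \<epsilon>)" by (simp add: add_mono)
  also have "\<dots> = ennreal (D + 2 powr p * (1 + D)) * \<epsilon>"
    using D by (simp add: ennreal_mult ennreal_plus algebra_simps)
  also have "D + 2 powr p * (1 + D) = (1 + 2 powr p) ^ Suc k * 3 - 1"
    unfolding D_def by (simp add: algebra_simps)
  finally show ?case .
qed


lemma pint_finite_diff:
  fixes f g :: "real \<Rightarrow> 'a::{real_normed_vector, second_countable_topology}"
  assumes "0 < p" "f \<in> borel_measurable borel" "g \<in> borel_measurable borel" "A \<in> sets borel"
    and "pint p A f < \<infinity>" "pint p A g < \<infinity>"
  shows "pint p A (\<lambda>x. f x - g x) < \<infinity>"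
  using pint_diff_le[OF assms(1-4)] assms(5,6)
  by (elim le_less_trans) (simp add: ennreal_mult_less_top)

text \<open>In the induction step the first difference is approximated and its antidifference subtracted, so
  that \<open>f\<close> becomes almost \<open>1\<close>-periodic; then the order of its differences can be lowered.\<close>

lemma strong_whitney:
  fixes p :: real
  assumes p: "0 < p"
  shows "\<exists>d::nat. \<forall>n::nat. \<exists>C\<ge>0. \<forall>(f :: real \<Rightarrow> 'a::{real_normed_vector, second_countable_topology}) \<epsilon>.
    f \<in> borel_measurable borel \<longrightarrow> pint p {0..<real (n + d)} f < \<infinity> \<longrightarrow>
    (\<forall>hs. length hs = Suc r \<longrightarrow> set hs \<subseteq> {0..1} \<longrightarrow> pint p {0..<real (n + d)} (mdiff hs f) \<le> \<epsilon>) \<longrightarrow>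
    (\<exists>P\<in>vpoly (Suc r) UNIV. pint p {0..<real n} (\<lambda>t. f t - P t) \<le> ennreal C * \<epsilon>)"
proof -
  define W where "W r d n C \<longleftrightarrow> (\<forall>(f :: real \<Rightarrow> 'a) \<epsilon>.
    f \<in> borel_measurable borel \<longrightarrow> pint p {0..<real (n + d)} f < \<infinity> \<longrightarrow>
    (\<forall>hs. length hs = Suc r \<longrightarrow> set hs \<subseteq> {0..1} \<longrightarrow> pint p {0..<real (n + d)} (mdiff hs f) \<le> \<epsilon>) \<longrightarrow>
    (\<exists>P\<in>vpoly (Suc r) UNIV. pint p {0..<real n} (\<lambda>t. f t - P t) \<le> ennreal C * \<epsilon>))" for r d n C
  have "\<exists>d. \<forall>n. \<exists>C\<ge>0. W r d n C"
  proof (induction r)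
    case 0
    \<comment> \<open>One extra unit of length makes room for the starting half interval even when
      \<open>n = 0\<close>.\<close>
    show ?case
    proof (intro exI[of _ "1::nat"] allI)
      fix n :: nat
      let ?C = "(1 + 2 powr p) ^ (2 * n + 1) * 3 - 1"
      show "\<exists>C\<ge>0. W 0 1 n C"
        unfolding W_def
      proof (intro exI[of _ ?C] conjI allI impI)
        have "1 \<le> (1 + 2 powr p) ^ (2 * n + 1)" by (rule one_le_power) simp
        then show "0 \<le> ?C" by linarith
      next
        fix f :: "real \<Rightarrow> 'a" and \<epsilon>
        assume f [measurable]: "f \<in> borel_measurable borel"
          and hyp: "\<forall>hs. length hs = Suc 0 \<longrightarrow> set hs \<subseteq> {0..1} \<longrightarrow> pint p {0..<real (n + 1)} (mdiff hs f) \<le> \<epsilon>"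
        have le: "pint p {0..<real (n + 1)} (\<lambda>x. f (x + h) - f x) \<le> \<epsilon>" if "h \<in> {0..1}" for h
          using hyp[rule_format, of "[h]"] that by (simp add: pint_def)
        have "\<exists>c. pint p {0..<1/2} (\<lambda>x. f x - c) \<le> 2 * \<epsilon>"
        proof (rule half_interval_near_constant[OF p f])
          fix h :: real assume "h \<in> {0..1}"
          from le[OF this] show "pint p {0..<1/2} (\<lambda>x. f (x + h) - f x) \<le> \<epsilon>"
            by (rule order_trans[rotated]) (auto intro!: pint_mono p)
        qed
        then obtain c where c: "pint p {0..<1/2} (\<lambda>x. f x - c) \<le> 2 * \<epsilon>" by blast
        have len: "real (2 * n + 1 + 1) / 2 = real (n + 1)" by simp
        have "pint p {0..<real n} (\<lambda>x. f x - c) \<le> pint p {0..<real (n + 1)} (\<lambda>x. f x - c)"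
          by (intro pint_mono p) auto
        also have "\<dots> \<le> ennreal ?C * \<epsilon>"
          using near_constant_propagates[OF p f c, of "2 * n + 1", unfolded len] le[of "1/2"] by simp
        finally show "\<exists>P\<in>vpoly (Suc 0) UNIV. pint p {0..<real n} (\<lambda>t. f t - P t) \<le> ennreal ?C * \<epsilon>"
          using vpoly_monomial[of 0 c] by (intro bexI[of _ "\<lambda>_. c"]) auto
      qed
    qed
  next
    case (Suc r)
    then obtain d where IH: "\<forall>n. \<exists>C\<ge>0. W r d n C" ..
    \<comment> \<open>The lengths are found backwards. Lowering the order on length
      \<open>n + d\<close> needs almost periodicity on length \<open>n + d + 1 + r\<close>, which is
      \<open>n1\<close> below; approximating \<open>g\<close> there needs \<open>g\<close> on length
      \<open>n1 + d\<close>, and \<open>g\<close> reads \<open>f\<close> one unit further, up to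
      \<open>n1 + d + 1 = n + d'\<close>.\<close>
    define d' where "d' = 2 * d + 2 + r"
    show ?case
    proof (intro exI[of _ d'] allI)
      fix n :: nat
      define n1 where "n1 = n + d + 1 + r"
      obtain C1 where C1: "0 \<le> C1" "\<And>(f :: real \<Rightarrow> 'a) \<epsilon>. f \<in> borel_measurable borel \<Longrightarrow>
        pint p {0..<real (n1 + d)} f < \<infinity> \<Longrightarrow>
        (\<And>hs. length hs = Suc r \<Longrightarrow> set hs \<subseteq> {0..1} \<Longrightarrow> pint p {0..<real (n1 + d)} (mdiff hs f) \<le> \<epsilon>) \<Longrightarrow>
        \<exists>P\<in>vpoly (Suc r) UNIV. pint p {0..<real n1} (\<lambda>t. f t - P t) \<le> ennreal C1 * \<epsilon>"
        using IH[rule_format, of n1] unfolding W_def by auto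
      obtain C2 where C2: "0 \<le> C2" "\<And>(f :: real \<Rightarrow> 'a) \<epsilon>. f \<in> borel_measurable borel \<Longrightarrow>
        pint p {0..<real (n + d)} f < \<infinity> \<Longrightarrow>
        (\<And>hs. length hs = Suc r \<Longrightarrow> set hs \<subseteq> {0..1} \<Longrightarrow> pint p {0..<real (n + d)} (mdiff hs f) \<le> \<epsilon>) \<Longrightarrow>
        \<exists>P\<in>vpoly (Suc r) UNIV. pint p {0..<real n} (\<lambda>t. f t - P t) \<le> ennreal C2 * \<epsilon>"
        using IH[rule_format, of n] unfolding W_def by auto
      define K where "K = 1 / (1 - (3/4) powr p) * (3/2) powr p * 2 powr p * (1 + (2 * 2 powr p) ^ r)"
      have "(3/4) powr p < 1" using p powr_less_mono2[of p "3/4" 1] by simp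
      then have K: "0 \<le> K" unfolding K_def by simp
      show "\<exists>C\<ge>0. W (Suc r) d' n C"
        unfolding W_def
      proof (intro exI[of _ "C2 * (K * (1 + C1))"] conjI allI impI)
        show "0 \<le> C2 * (K * (1 + C1))" using C1(1) C2(1) K by simp
      next
        fix f :: "real \<Rightarrow> 'a" and \<epsilon>
        assume f [measurable]: "f \<in> borel_measurable borel" and fin: "pint p {0..<real (n + d')} f < \<infinity>"
          and hyp: "\<forall>hs. length hs = Suc (Suc r) \<longrightarrow> set hs \<subseteq> {0..1} \<longrightarrow> pint p {0..<real (n + d')} (mdiff hs f) \<le> \<epsilon>"
        define g where "g x = f (x + 1) - f x" for x
        have [measurable]: "g \<in> borel_measurable borel" unfolding g_def by measurable
        have fin_sub: "pint p {0..<u} f < \<infinity>" if "u \<le> real (n + d')" for u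
          using pint_mono[OF p, of "{0..<u}" "{0..<real (n + d')}" f] that fin by (auto intro: le_less_trans)
        have hyp_sub: "pint p {0..<u} (mdiff hs f) \<le> \<epsilon>"
          if "length hs = Suc (Suc r)" "set hs \<subseteq> {0..1}" "u \<le> real (n + d')" for hs u
          using pint_mono[OF p, of "{0..<u}" "{0..<real (n + d')}" "mdiff hs f"] that hyp by (auto intro: order_trans)
        have "\<exists>P\<in>vpoly (Suc r) UNIV. pint p {0..<real n1} (\<lambda>t. g t - P t) \<le> ennreal C1 * \<epsilon>"
        proof (rule C1(2))
          have "pint p {0..<real (n1 + d)} (\<lambda>x. f (x + 1)) \<le> pint p {0..<real (n + d')} f"
            by (intro pint_translate p f) (auto simp: n1_def d'_def)
          then show "pint p {0..<real (n1 + d)} g < \<infinity>"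
            unfolding g_def using fin by (intro pint_finite_diff p fin_sub) (auto simp: n1_def d'_def intro: le_less_trans)
        next
          fix hs :: "real list" assume hs: "length hs = Suc r" "set hs \<subseteq> {0..1}"
          have "mdiff hs g = mdiff (1 # hs) f"
            unfolding g_def by (rule ext) (rule mdiff_difference)
          then show "pint p {0..<real (n1 + d)} (mdiff hs g) \<le> \<epsilon>"
            using hyp_sub[of "1 # hs" "real (n1 + d)"] hs by (simp add: n1_def d'_def del: mdiff.simps)
        qed simp
        then obtain P1 where P1: "P1 \<in> vpoly (Suc r) UNIV"
          "pint p {0..<real n1} (\<lambda>t. g t - P1 t) \<le> ennreal C1 * \<epsilon>" by blast
        obtain Q where Q: "Q \<in> vpoly (Suc (Suc r)) UNIV" "\<And>t. Q (t + 1) - Q t = P1 t"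
          using vpoly_antidifference[OF P1(1)] by metis
        note [measurable] = vpoly_measurable[OF Q(1)]
        define f1 where "f1 x = f x - Q x" for x
        have [measurable]: "f1 \<in> borel_measurable borel" unfolding f1_def by measurable
        have f1_diff: "f1 (x + 1) - f1 x = g x - P1 x" for x
          unfolding f1_def g_def Q(2)[symmetric] by simp
        have f1_fin: "pint p {0..<u} f1 < \<infinity>" if "u \<le> real (n + d')" for u
          unfolding f1_def by (intro pint_finite_diff p fin_sub that pint_vpoly_finite[OF Q(1)]) auto
        \<comment> \<open>A common error for both inputs of the order reduction:
          \<open>\<epsilon>\<close> bounds the highest differences and
          \<open>ennreal C1 * \<epsilon>\<close> the defect of periodicity.\<close>
        define \<eta> where "\<eta> = ennreal (1 + C1) * \<epsilon>"
        have \<eta>: "\<eta> = \<epsilon> + ennreal C1 * \<epsilon>" unfolding \<eta>_def using C1(1) by (simp add: ennreal_plus distrib_right)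
        have "\<exists>P\<in>vpoly (Suc r) UNIV. pint p {0..<real n} (\<lambda>t. f1 t - P t) \<le> ennreal C2 * (ennreal K * \<eta>)"
        proof (rule C2(2))
          fix hs :: "real list" assume hs: "length hs = Suc r" "set hs \<subseteq> {0..1}"
          then obtain h t where ht: "hs = h # t" "length t = r" by (cases hs) auto
          have "pint p {0..<real (n + d)} (mdiff (h # t) f1) \<le> ennreal
            (1 / (1 - (3/4) powr p) * (3/2) powr p * 2 powr p * (1 + (2 * 2 powr p) ^ length t)) * \<eta>"
          proof (rule almost_periodic_lower_difference[OF p])
            show "pint p {0..<real (n + d) + 1 + real (length t)} f1 < \<infinity>"
              by (rule f1_fin) (simp add: ht d'_def)
            have "pint p {0..<real (n + d) + 1 + real (length t)} (\<lambda>x. f1 (x + 1) - f1 x) \<le> ennreal C1 * \<epsilon>"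
              using P1(2) by (simp add: ht f1_diff n1_def add_ac)
            then show "pint p {0..<real (n + d) + 1 + real (length t)} (\<lambda>x. f1 (x + 1) - f1 x) \<le> \<eta>"
              unfolding \<eta> by (rule order_trans) simp
            fix k :: real assume k: "k \<in> {0..1}"
            \<comment> \<open>\<open>Q\<close> has order \<open>r + 2\<close>, which is the number
              of steps here, so subtracting it leaves these differences unchanged.\<close>
            have "mdiff (k # k # t) f1 x = mdiff (k # k # t) f x" for x
              using mdiff_vpoly[of Q "k # k # t" x] Q(1) unfolding f1_def mdiff_diff by (simp add: ht)
            then have "mdiff (k # k # t) f1 = mdiff (k # k # t) f" by blast
            then have "pint p {0..<real (n + d)} (mdiff (k # k # t) f1) \<le> \<epsilon>"
              using hyp_sub[of "k # k # t" "real (n + d)"] hs k by (simp add: ht d'_def)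
            then show "pint p {0..<real (n + d)} (mdiff (k # k # t) f1) \<le> \<eta>"
              unfolding \<eta> by (rule order_trans) simp
          qed (use hs ht in auto)
          then show "pint p {0..<real (n + d)} (mdiff hs f1) \<le> ennreal K * \<eta>"
            unfolding ht K_def ht(2) .
        qed (use f1_fin in \<open>auto simp: d'_def\<close>)
        then obtain P2 where P2: "P2 \<in> vpoly (Suc r) UNIV"
          "pint p {0..<real n} (\<lambda>t. f1 t - P2 t) \<le> ennreal C2 * (ennreal K * \<eta>)" by blast
        have "ennreal C2 * (ennreal K * \<eta>) = ennreal (C2 * (K * (1 + C1))) * \<epsilon>"
          unfolding \<eta>_def using C1(1) C2(1) K by (simp add: ennreal_mult mult.assoc)
        moreover have "(\<lambda>t. Q t + P2 t) \<in> vpoly (Suc (Suc r)) UNIV"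
          by (intro vpoly_add Q vpoly_mono[OF P2(1)]) simp
        ultimately show "\<exists>P\<in>vpoly (Suc (Suc r)) UNIV. pint p {0..<real n} (\<lambda>t. f t - P t) \<le>
            ennreal (C2 * (K * (1 + C1))) * \<epsilon>"
          using P2(2) unfolding f1_def by (intro bexI[of _ "\<lambda>t. Q t + P2 t"]) (auto simp: diff_diff_eq)
      qed
    qed
  qed
  then show ?thesis unfolding W_def .
qed

section \<open>Averaged moduli of Borel functions\<close>

lemma pint_scaleR:
  fixes f :: "real \<Rightarrow> 'a::{real_normed_vector, second_countable_topology}"
  assumes [measurable]: "f \<in> borel_measurable borel" "A \<in> sets borel"
  shows "pint p A (\<lambda>x. c *\<^sub>R f x) = ennreal (\<bar>c\<bar> powr p) * pint p A f"
  unfolding pint_def by (simp add: powr_mult ennreal_mult mult.assoc nn_integral_cmult)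

lemma pint_sum_le:
  fixes g :: "'i \<Rightarrow> real \<Rightarrow> 'a::{real_normed_vector, second_countable_topology}"
  assumes p: "0 < p" and I: "finite I"
    and [measurable]: "\<And>i. i \<in> I \<Longrightarrow> g i \<in> borel_measurable borel" "A \<in> sets borel"
  shows "pint p A (\<lambda>x. \<Sum>i\<in>I. g i x) \<le> ennreal ((2 powr p) ^ card I) * (\<Sum>i\<in>I. pint p A (g i))"
proof -
  have "pint p A (\<lambda>x. \<Sum>i\<in>I. g i x) \<le>
      (\<integral>\<^sup>+ x. ennreal ((2 powr p) ^ card I) * (\<Sum>i\<in>I. ennreal (norm (g i x) powr p) * indicator A x) \<partial>lborel)"
    unfolding pint_def
  proof (rule nn_integral_mono)
    fix x
    have "ennreal (norm (\<Sum>i\<in>I. g i x) powr p) \<le> ennreal ((2 powr p) ^ card I * (\<Sum>i\<in>I. norm (g i x) powr p))"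
      by (rule ennreal_leI) (rule powr_norm_sum_le[OF p I])
    also have "\<dots> = ennreal ((2 powr p) ^ card I) * (\<Sum>i\<in>I. ennreal (norm (g i x) powr p))"
      by (simp add: ennreal_mult' sum_ennreal)
    finally show "ennreal (norm (\<Sum>i\<in>I. g i x) powr p) * indicator A x \<le>
      ennreal ((2 powr p) ^ card I) * (\<Sum>i\<in>I. ennreal (norm (g i x) powr p) * indicator A x)"
      by (auto simp: indicator_def)
  qed
  also have "\<dots> = ennreal ((2 powr p) ^ card I) * (\<Sum>i\<in>I. pint p A (g i))"
    unfolding pint_def by (subst nn_integral_cmult) (auto simp: nn_integral_sum)
  finally show ?thesis .
qed

lemma pint_modulus_domain:
  fixes f :: "real \<Rightarrow> 'a::{real_normed_vector, second_countable_topology}"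
  assumes [measurable]: "f \<in> borel_measurable borel"
  shows "pint p (modulus_domain r a b u) (\<lambda>(y, v). fdiff r v f y) =
    (\<integral>\<^sup>+ h. pint p {y. a \<le> y \<and> y + real r * h < b} (fdiff r h f) * indicator {0<..u} h \<partial>lborel)"
proof -
  let ?F = "\<lambda>z. ennreal (norm (case z of (y, v) \<Rightarrow> fdiff r v f y) powr p) * indicator (modulus_domain r a b u) z"
  note [measurable] = fdiff_measurable_pair[OF assms, of r]
  have "?F \<in> borel_measurable (lborel \<Otimes>\<^sub>M lborel)" unfolding lborel_prod by measurable
  then have "pint p (modulus_domain r a b u) (\<lambda>(y, v). fdiff r v f y) = (\<integral>\<^sup>+ h. \<integral>\<^sup>+ y. ?F (y, h) \<partial>lborel \<partial>lborel)"
    unfolding pint_def by (subst lborel_pair.nn_integral_snd) (simp_all add: lborel_prod)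
  also have "\<dots> = (\<integral>\<^sup>+ h. pint p {y. a \<le> y \<and> y + real r * h < b} (fdiff r h f) * indicator {0<..u} h \<partial>lborel)"
  proof (rule nn_integral_cong)
    fix h :: real
    show "(\<integral>\<^sup>+ y. ?F (y, h) \<partial>lborel) = pint p {y. a \<le> y \<and> y + real r * h < b} (fdiff r h f) * indicator {0<..u} h"
      by (cases "h \<in> {0<..u}") (auto simp: pint_def modulus_domain_def indicator_def intro!: nn_integral_cong)
  qed
  finally show ?thesis .
qed

text \<open>A point near the right end is reached from the left by the last node of a difference with a
  large step.\<close>

lemma extend_to_right_end:
  fixes g :: "real \<Rightarrow> 'a::{real_normed_vector, second_countable_topology}" and D m :: real
  assumes p: "0 < p" and r: "1 \<le> r" and D: "0 < D" and m: "m = 4 * real r * D"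
    and g [measurable]: "g \<in> borel_measurable borel"
    and near: "pint p {0..<m - D} g \<le> N"
    and modulus: "pint p (modulus_domain r 0 m (2 * D)) (\<lambda>(y, v). fdiff r v g y) \<le> N"
  shows "ennreal D * pint p {m - D..<m} g \<le>
    ennreal (2 powr p * (1 + (2 powr p) ^ r * (\<Sum>i<r. real (r choose i) powr p) * D)) * N"
proof -
  define c where "c i = real (r choose i) * (- 1) ^ (r - i)" for i
  define S where "S = (2 powr p) ^ r * (\<Sum>i<r. real (r choose i) powr p)"
  have S: "0 \<le> S" unfolding S_def by (simp add: sum_nonneg)
  let ?E = "\<lambda>h. pint p {y. 0 \<le> y \<and> y + real r * h < m} (fdiff r h g)"
  have step: "pint p {m - D..<m} g \<le> ennreal (2 powr p) * (?E h + ennreal S * N)" if h: "h \<in> {D<..2 * D}" for h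
  proof -
    \<comment> \<open>Since \<open>h > D\<close>, every node \<open>y + i h\<close> with
      \<open>i < r\<close> lies to the left of \<open>m - D\<close>, where \<open>near\<close>
      applies. Since \<open>h \<le> 2 * D\<close> and \<open>m = 4 * real r * D\<close>, the base
      points \<open>y\<close> are nonnegative.\<close>
    let ?B = "{m - D - real r * h..<m - real r * h}"
    have "real r * h \<le> real r * (2 * D)" using h r by (intro mult_left_mono) auto
    moreover have "D \<le> real r * D" using r D by simp
    moreover have "m = 4 * (real r * D)" "real r * (2 * D) = 2 * (real r * D)" unfolding m by simp_all
    ultimately have lower: "0 \<le> m - D - real r * h" using D by linarith
    note [measurable] = fdiff_measurable[OF g, of r h]
    have last: "g (y + real r * h) = fdiff r h g y - (\<Sum>i<r. c i *\<^sub>R g (y + real i * h))" for y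
      unfolding fdiff_def c_def by (simp flip: lessThan_Suc_atMost)
    have "pint p {m - D..<m} g = pint p {m - D..<m} (\<lambda>x. g ((x + - (real r * h)) + real r * h))" by simp
    also have "\<dots> \<le> pint p ?B (\<lambda>y. g (y + real r * h))"
      by (intro pint_translate[OF p, where f = "\<lambda>y. g (y + real r * h)"]) auto
    also have "\<dots> \<le> ennreal (2 powr p) * (pint p ?B (fdiff r h g) + pint p ?B (\<lambda>y. \<Sum>i<r. c i *\<^sub>R g (y + real i * h)))"
      unfolding last by (intro pint_diff_le p) auto
    also have "\<dots> \<le> ennreal (2 powr p) * (?E h + ennreal S * N)"
    proof (intro mult_left_mono add_mono)
      show "pint p ?B (fdiff r h g) \<le> ?E h" using lower by (intro pint_mono p) auto
      have "pint p ?B (\<lambda>y. \<Sum>i<r. c i *\<^sub>R g (y + real i * h)) \<le>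
        ennreal ((2 powr p) ^ card {..<r}) * (\<Sum>i<r. pint p ?B (\<lambda>y. c i *\<^sub>R g (y + real i * h)))"
        by (intro pint_sum_le p) auto
      also have "\<dots> \<le> ennreal ((2 powr p) ^ card {..<r}) * (\<Sum>i<r. ennreal (real (r choose i) powr p) * N)"
      proof (intro mult_left_mono sum_mono)
        fix i assume "i \<in> {..<r}"
        then have "real i * h + h \<le> real r * h"
          using h D by (auto simp flip: distrib_right[of _ 1 h, simplified] intro!: mult_right_mono)
        then have "pint p ?B (\<lambda>y. g (y + real i * h)) \<le> pint p {0..<m - D} g"
          using h D lower by (intro pint_translate p) auto
        also note near
        finally have "pint p ?B (\<lambda>y. g (y + real i * h)) \<le> N" .
        moreover have "pint p ?B (\<lambda>y. c i *\<^sub>R g (y + real i * h)) =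
          ennreal (real (r choose i) powr p) * pint p ?B (\<lambda>y. g (y + real i * h))"
          by (subst pint_scaleR) (auto simp: c_def abs_mult power_abs)
        ultimately show "pint p ?B (\<lambda>y. c i *\<^sub>R g (y + real i * h)) \<le> ennreal (real (r choose i) powr p) * N"
          by (simp add: mult_left_mono)
      qed auto
      also have "\<dots> = ennreal S * N"
        unfolding S_def sum_distrib_right[symmetric] by (simp add: sum_ennreal ennreal_mult' mult.assoc)
      finally show "pint p ?B (\<lambda>y. \<Sum>i<r. c i *\<^sub>R g (y + real i * h)) \<le> ennreal S * N" .
    qed auto
    finally show ?thesis .
  qed
  have [measurable]: "?E \<in> borel_measurable borel"
  proof -
    have "(\<lambda>h. \<integral>\<^sup>+ y. ennreal (norm (fdiff r h g y) powr p) * indicator {z. 0 \<le> fst z \<and> fst z + real r * snd z < m} (y, h) \<partial>lborel)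
      \<in> borel_measurable borel"
      unfolding fdiff_def by measurable
    then show ?thesis by (simp add: pint_def indicator_def)
  qed
  \<comment> \<open>Only the integral of \<open>?E\<close> over the step is controlled, not its
    individual values, so the estimate is integrated over (D, 2 D], a range of length
    \<open>D\<close>.\<close>
  have "ennreal D * pint p {m - D..<m} g = (\<integral>\<^sup>+ h. pint p {m - D..<m} g * indicator {D<..2 * D} h \<partial>lborel)"
    using D by (simp add: nn_integral_cmult mult.commute)
  also have "\<dots> \<le> (\<integral>\<^sup>+ h. ennreal (2 powr p) * (?E h * indicator {0<..2 * D} h + ennreal S * N * indicator {D<..2 * D} h) \<partial>lborel)"
  proof (rule nn_integral_mono)
    fix h
    show "pint p {m - D..<m} g * indicator {D<..2 * D} h \<le>
      ennreal (2 powr p) * (?E h * indicator {0<..2 * D} h + ennreal S * N * indicator {D<..2 * D} h)"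
      using step[of h] D by (cases "h \<in> {D<..2 * D}") auto
  qed
  also have "\<dots> = ennreal (2 powr p) * (pint p (modulus_domain r 0 m (2 * D)) (\<lambda>(y, v). fdiff r v g y) + ennreal S * N * ennreal D)"
    unfolding pint_modulus_domain[OF g] using D by (simp add: nn_integral_cmult nn_integral_add)
  also have "\<dots> \<le> ennreal (2 powr p) * (N + ennreal S * N * ennreal D)"
    using modulus by (intro mult_left_mono add_mono) auto
  also have "\<dots> = ennreal (2 powr p * (1 + S * D)) * N"
    using S D by (simp add: ennreal_mult ennreal_plus algebra_simps)
  finally show ?thesis unfolding S_def .
qed

lemma whitney_unit:
  assumes p: "0 < p" and r: "1 \<le> r"
  shows "\<exists>m>0. \<exists>C\<ge>0. \<forall>f :: real \<Rightarrow> 'a::{real_normed_vector, second_countable_topology}.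
    f \<in> borel_measurable borel \<longrightarrow> pint p {0..<m} f < \<infinity> \<longrightarrow>
    (\<exists>P\<in>vpoly r UNIV. pint p {0..<m} (\<lambda>t. f t - P t) \<le>
      ennreal C * pint p (modulus_domain r 0 m (m / (2 * real r))) (\<lambda>(y, v). fdiff r v f y))"
proof -
  have "Suc (r - 1) = r" using r by simp
  then obtain d where d: "\<forall>n::nat. \<exists>C\<ge>0. \<forall>(f :: real \<Rightarrow> 'a) \<epsilon>.
    f \<in> borel_measurable borel \<longrightarrow> pint p {0..<real (n + d)} f < \<infinity> \<longrightarrow>
    (\<forall>hs. length hs = r \<longrightarrow> set hs \<subseteq> {0..1} \<longrightarrow> pint p {0..<real (n + d)} (mdiff hs f) \<le> \<epsilon>) \<longrightarrow>
    (\<exists>P\<in>vpoly r UNIV. pint p {0..<real n} (\<lambda>t. f t - P t) \<le> ennreal C * \<epsilon>)"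
    using strong_whitney[OF p, of "r - 1", where 'a = 'a] by (elim exE) (simp only:)
  \<comment> \<open>\<open>D\<close> adds up the lengths lost: \<open>d\<close> in the strong form,
    \<open>r\<close> and \<open>r * (r + 1)\<close> in Djokovic's formula. With
    \<open>m = 4 r D\<close> the prescribed step bound \<open>m / (2 r)\<close> becomes
    \<open>2 D\<close>, and \<open>n = m - D\<close>, which is the geometry required for the
    extension to the right end.\<close>
  define D where "D = d + r + r * (r + 1)"
  define n where "n = (4 * r - 1) * D"
  define m where "m = 4 * real r * real D"
  have "0 < D" using r unfolding D_def by simp
  then have D: "0 < real D" by simp
  have n: "real n = m - real D" using r unfolding n_def m_def by (simp add: of_nat_diff algebra_simps)
  have m: "0 < m" "m / (2 * real r) = 2 * real D" using r D unfolding m_def by auto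
  obtain C0 where C0: "0 \<le> C0" "\<And>(f :: real \<Rightarrow> 'a) \<epsilon>. f \<in> borel_measurable borel \<Longrightarrow>
    pint p {0..<real (n + d)} f < \<infinity> \<Longrightarrow>
    (\<And>hs. length hs = r \<Longrightarrow> set hs \<subseteq> {0..1} \<Longrightarrow> pint p {0..<real (n + d)} (mdiff hs f) \<le> \<epsilon>) \<Longrightarrow>
    \<exists>P\<in>vpoly r UNIV. pint p {0..<real n} (\<lambda>t. f t - P t) \<le> ennreal C0 * \<epsilon>"
    using d[rule_format, of n] by auto
  \<comment> \<open>The summand 1 lets the single quantity \<open>ennreal C1 * W\<close> dominate
    both the error on the left part and the modulus \<open>W\<close> itself.\<close>
  define C1 where "C1 = C0 * (2 * 2 powr p) ^ r + 1"
  define C2 where "C2 = 2 powr p * (1 + (2 powr p) ^ r * (\<Sum>i<r. real (r choose i) powr p) * real D)"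
  have C1: "0 \<le> C1" unfolding C1_def using C0(1) by simp
  have C2: "0 \<le> C2" unfolding C2_def by (simp add: sum_nonneg)
  show ?thesis
  proof (rule exI[of _ m], rule conjI[OF m(1)], rule exI[of _ "C1 + C2 / real D * C1"], intro conjI allI impI)
    show "0 \<le> C1 + C2 / real D * C1" using C1 C2 by simp
    fix f :: "real \<Rightarrow> 'a"
    assume f [measurable]: "f \<in> borel_measurable borel" and fin: "pint p {0..<m} f < \<infinity>"
    define W where "W = pint p (modulus_domain r 0 m (2 * real D)) (\<lambda>(y, v). fdiff r v f y)"
    have "real d \<le> real D" unfolding D_def by (simp del: of_nat_add)
    then have nd: "real (n + d) \<le> m" using n by simp
    have "\<exists>P\<in>vpoly r UNIV. pint p {0..<real n} (\<lambda>t. f t - P t) \<le> ennreal C0 * (ennreal ((2 * 2 powr p) ^ r) * W)"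
    proof (rule C0(2)[OF f])
      show "pint p {0..<real (n + d)} f < \<infinity>"
        using pint_mono[OF p, of "{0..<real (n + d)}" "{0..<m}" f] nd fin by (auto intro: le_less_trans)
      fix hs :: "real list" assume hs: "length hs = r" "set hs \<subseteq> {0..1}"
      have "real (n + d) + real r + real r * (real r + 1) = m" using n unfolding D_def by (simp add: algebra_simps)
      moreover have "real r + 1 \<le> 2 * real D"
      proof -
        have "r + 1 \<le> r * (r + 1)" using r by simp
        then have "r + 1 \<le> D" unfolding D_def by simp
        then show ?thesis by linarith
      qed
      ultimately show "pint p {0..<real (n + d)} (mdiff hs f) \<le> ennreal ((2 * 2 powr p) ^ r) * W"
        unfolding W_def by (intro strong_le_averaged_modulus p f hs) auto
    qed
    then obtain P where P: "P \<in> vpoly r UNIV"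
      "pint p {0..<real n} (\<lambda>t. f t - P t) \<le> ennreal C0 * (ennreal ((2 * 2 powr p) ^ r) * W)" by blast
    note [measurable] = vpoly_measurable[OF P(1)]
    define g where "g t = f t - P t" for t
    have [measurable]: "g \<in> borel_measurable borel" unfolding g_def by measurable
    have "ennreal C1 * W = ennreal C0 * (ennreal ((2 * 2 powr p) ^ r) * W) + W"
      unfolding C1_def using C0(1) by (simp add: ennreal_mult ennreal_plus algebra_simps)
    then have near: "pint p {0..<m - real D} g \<le> ennreal C1 * W" and W: "W \<le> ennreal C1 * W"
      using P(2) unfolding g_def n by (auto intro: order_trans)
    have "fdiff r v g y = fdiff r v f y" for v y
      unfolding g_def fdiff_diff using fdiff_vpoly[OF P(1)] by simp
    then have ext: "ennreal (real D) * pint p {m - real D..<m} g \<le> ennreal C2 * (ennreal C1 * W)"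
      unfolding C2_def using W by (intro extend_to_right_end p r D m_def near) (auto simp: W_def)
    have 1: "ennreal (1 / real D) * ennreal (real D) = 1"
      using D by (subst ennreal_mult[symmetric]) auto
    have "pint p {m - real D..<m} g = ennreal (1 / real D) * (ennreal (real D) * pint p {m - real D..<m} g)"
      by (simp only: 1 mult_1 flip: mult.assoc)
    also have "\<dots> \<le> ennreal (1 / real D) * (ennreal C2 * (ennreal C1 * W))"
      using ext by (intro mult_left_mono) auto
    also have "\<dots> = ennreal (1 / real D * C2 * C1) * W"
      using C1 C2 by (simp only: ennreal_mult' mult.assoc zero_le_divide_1_iff of_nat_0_le_iff)
    also have "1 / real D * C2 * C1 = C2 / real D * C1" by simp
    finally have right: "pint p {m - real D..<m} g \<le> ennreal (C2 / real D * C1) * W" .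
    have "{0..<m} = {0..<m - real D} \<union> {m - real D..<m}" using n D of_nat_0_le_iff[of n, where 'a = real] by auto
    then have "pint p {0..<m} g \<le> pint p {0..<m - real D} g + pint p {m - real D..<m} g"
      using pint_Un_le[OF p, of g "{0..<m - real D}" "{m - real D..<m}"] by simp
    also have "\<dots> \<le> ennreal C1 * W + ennreal (C2 / real D * C1) * W"
      using near right by (rule add_mono)
    also have "\<dots> = ennreal (C1 + C2 / real D * C1) * W"
      using C1 C2 by (simp add: ennreal_plus distrib_right)
    finally show "\<exists>P\<in>vpoly r UNIV. pint p {0..<m} (\<lambda>t. f t - P t) \<le>
      ennreal (C1 + C2 / real D * C1) * pint p (modulus_domain r 0 m (m / (2 * real r))) (\<lambda>(y, v). fdiff r v f y)"
      using P(1) unfolding g_def W_def m(2) by blast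
  qed
qed

section \<open>Rescaling to arbitrary intervals\<close>

lemma pint_affine:
  fixes f :: "real \<Rightarrow> 'a::{real_normed_vector, second_countable_topology}"
  assumes [measurable]: "f \<in> borel_measurable borel" "A \<in> sets borel" and "0 < l"
  shows "pint p A f = ennreal l * pint p {x. a + l * x \<in> A} (\<lambda>x. f (a + l * x))"
  unfolding pint_def using assms(3)
  by (subst nn_integral_real_affine[of _ l a]) (auto simp: indicator_def)

text \<open>Point and step are scaled together and contribute one Jacobian factor each, hence the
  square of \<open>l\<close>.\<close>

lemma pint_modulus_domain_affine:
  fixes f :: "real \<Rightarrow> 'a::{real_normed_vector, second_countable_topology}"
  assumes f [measurable]: "f \<in> borel_measurable borel" and l: "0 < l"
  shows "pint p (modulus_domain r a (a + l * m) (l * u)) (\<lambda>(y, v). fdiff r v f y) =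
    ennreal (l\<^sup>2) * pint p (modulus_domain r 0 m u) (\<lambda>(y, v). fdiff r v (\<lambda>x. f (a + l * x)) y)"
proof -
  let ?F = "\<lambda>x. f (a + l * x)"
  let ?E = "\<lambda>h. pint p {y. a \<le> y \<and> y + real r * h < a + l * m} (fdiff r h f)"
  have [measurable]: "?E \<in> borel_measurable borel"
  proof -
    have "(\<lambda>h. \<integral>\<^sup>+ y. ennreal (norm (fdiff r h f y) powr p) *
        indicator {z. a \<le> fst z \<and> fst z + real r * snd z < a + l * m} (y, h) \<partial>lborel) \<in> borel_measurable borel"
      unfolding fdiff_def by measurable
    then show ?thesis by (simp add: pint_def indicator_def)
  qed
  have E: "?E (l * k) = ennreal l * pint p {x. 0 \<le> x \<and> x + real r * k < m} (fdiff r k ?F)" for k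
  proof -
    have "?E (l * k) = ennreal l * pint p {x. a + l * x \<in> {y. a \<le> y \<and> y + real r * (l * k) < a + l * m}}
      (\<lambda>x. fdiff r (l * k) f (a + l * x))"
      by (intro pint_affine l fdiff_measurable f) auto
    moreover have "a + l * x \<in> {y. a \<le> y \<and> y + real r * (l * k) < a + l * m} \<longleftrightarrow> 0 \<le> x \<and> x + real r * k < m" for x
    proof -
      have "a + l * x + real r * (l * k) < a + l * m \<longleftrightarrow> l * (x + real r * k) < l * m" by (simp add: algebra_simps)
      then show ?thesis using l by (simp add: zero_le_mult_iff)
    qed
    moreover have "fdiff r (l * k) f (a + l * x) = fdiff r k ?F x" for x
      unfolding fdiff_def by (simp add: algebra_simps)
    ultimately show ?thesis by simp
  qed
  have "pint p (modulus_domain r a (a + l * m) (l * u)) (\<lambda>(y, v). fdiff r v f y) =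
    (\<integral>\<^sup>+ h. ?E h * indicator {0<..l * u} h \<partial>lborel)"
    by (rule pint_modulus_domain[OF f])
  also have "\<dots> = ennreal l * (\<integral>\<^sup>+ k. ?E (l * k) * indicator {0<..l * u} (l * k) \<partial>lborel)"
    using l by (subst nn_integral_real_affine[of _ l 0]) auto
  also have "(\<integral>\<^sup>+ k. ?E (l * k) * indicator {0<..l * u} (l * k) \<partial>lborel) =
    (\<integral>\<^sup>+ k. ennreal l * (pint p {x. 0 \<le> x \<and> x + real r * k < m} (fdiff r k ?F) * indicator {0<..u} k) \<partial>lborel)"
    unfolding E using l by (intro nn_integral_cong) (auto simp: indicator_def zero_less_mult_iff)
  also have "\<dots> = ennreal l * pint p (modulus_domain r 0 m u) (\<lambda>(y, v). fdiff r v ?F y)"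
  proof -
    have [measurable]: "(\<lambda>k. pint p {x. 0 \<le> x \<and> x + real r * k < m} (fdiff r k ?F)) \<in> borel_measurable borel"
    proof -
      have "(\<lambda>k. \<integral>\<^sup>+ y. ennreal (norm (fdiff r k ?F y) powr p) *
          indicator {z. 0 \<le> fst z \<and> fst z + real r * snd z < m} (y, k) \<partial>lborel) \<in> borel_measurable borel"
        unfolding fdiff_def by measurable
      then show ?thesis by (simp add: pint_def indicator_def)
    qed
    show ?thesis by (subst pint_modulus_domain) (auto simp: nn_integral_cmult)
  qed
  finally show ?thesis using l by (simp add: power2_eq_square ennreal_mult mult.assoc)
qed

text \<open>The error scales like \<open>l\<close> and the planar integral like the square of
  \<open>l\<close>, which forces the factor \<open>1 / (b - a)\<close>. Up to \<open>2 r\<close>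
  this is the normalisation by the step bound in the averaged modulus.\<close>

lemma whitney_interval:
  assumes p: "0 < p" and r: "1 \<le> r"
  shows "\<exists>C\<ge>0. \<forall>a b. \<forall>f :: real \<Rightarrow> 'a::{real_normed_vector, second_countable_topology}. a < b \<longrightarrow>
    f \<in> borel_measurable borel \<longrightarrow> pint p {a..<b} f < \<infinity> \<longrightarrow>
    (\<exists>P\<in>vpoly r UNIV. pint p {a..<b} (\<lambda>t. f t - P t) \<le>
      ennreal (C / (b - a)) * pint p (modulus_domain r a b ((b - a) / (2 * real r))) (\<lambda>(y, v). fdiff r v f y))"
proof -
  define U where "U m C \<longleftrightarrow> (\<forall>f :: real \<Rightarrow> 'a.
    f \<in> borel_measurable borel \<longrightarrow> pint p {0..<m} f < \<infinity> \<longrightarrow>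
    (\<exists>P\<in>vpoly r UNIV. pint p {0..<m} (\<lambda>t. f t - P t) \<le>
      ennreal C * pint p (modulus_domain r 0 m (m / (2 * real r))) (\<lambda>(y, v). fdiff r v f y)))" for m C
  have "\<exists>m>0. \<exists>C\<ge>0. U m C" unfolding U_def by (rule whitney_unit[OF p r])
  then obtain m C where m: "0 < m" and C: "0 \<le> C" and U: "U m C" by blast
  show ?thesis
  proof (intro exI[of _ "C * m"] conjI allI impI)
    show "0 \<le> C * m" using C m by simp
    fix a b :: real and f :: "real \<Rightarrow> 'a"
    assume ab: "a < b" and f [measurable]: "f \<in> borel_measurable borel" and fin: "pint p {a..<b} f < \<infinity>"
    define l where "l = (b - a) / m"
    have l: "0 < l" "l * m = b - a" using ab m unfolding l_def by auto
    define F where "F x = f (a + l * x)" for x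
    have F [measurable]: "F \<in> borel_measurable borel" unfolding F_def by measurable
    have set: "{x. a + l * x \<in> {a..<b}} = {0..<m}"
    proof -
      have "a + l * x < b \<longleftrightarrow> x < m" for x
      proof -
        have "a + l * x < b \<longleftrightarrow> l * x < l * m" unfolding l(2) by linarith
        then show ?thesis using l(1) by simp
      qed
      moreover have "a \<le> a + l * x \<longleftrightarrow> 0 \<le> x" for x using l(1) by (simp add: zero_le_mult_iff)
      ultimately show ?thesis by (simp add: atLeastLessThan_def atLeast_def lessThan_def Collect_conj_eq)
    qed
    have scale: "pint p {a..<b} g = ennreal l * pint p {0..<m} (\<lambda>x. g (a + l * x))"
      if "g \<in> borel_measurable borel" for g :: "real \<Rightarrow> 'a"
      using pint_affine[OF that _ l(1), of "{a..<b}" p a] unfolding set by simp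
    have "pint p {0..<m} F < \<infinity>"
      using fin l unfolding scale[OF f] F_def by (auto simp: ennreal_mult_less_top)
    with U F obtain Q where Q: "Q \<in> vpoly r UNIV" "pint p {0..<m} (\<lambda>t. F t - Q t) \<le>
      ennreal C * pint p (modulus_domain r 0 m (m / (2 * real r))) (\<lambda>(y, v). fdiff r v F y)" unfolding U_def by blast
    define P where "P t = Q (- a / l + (1 / l) * t)" for t
    have P: "P \<in> vpoly r UNIV" unfolding P_def by (rule vpoly_affine[OF Q(1)])
    note [measurable] = vpoly_measurable[OF P]
    have PQ: "P (a + l * x) = Q x" for x
      unfolding P_def using l(1) by (intro arg_cong[where f = Q]) (simp add: field_simps)
    let ?W = "pint p (modulus_domain r a b ((b - a) / (2 * real r))) (\<lambda>(y, v). fdiff r v f y)"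
    let ?W' = "pint p (modulus_domain r 0 m (m / (2 * real r))) (\<lambda>(y, v). fdiff r v F y)"
    have W: "?W = ennreal (l\<^sup>2) * ?W'"
      using pint_modulus_domain_affine[OF f l(1), of p r a m "m / (2 * real r)"] l(2)
      by (simp add: F_def[abs_def])
    have "pint p {a..<b} (\<lambda>t. f t - P t) = ennreal l * pint p {0..<m} (\<lambda>t. F t - Q t)"
      by (subst scale) (auto simp: F_def PQ)
    also have "\<dots> \<le> ennreal l * (ennreal C * ?W')" using Q(2) by (intro mult_left_mono) auto
    also have "\<dots> = ennreal (C * m / (b - a)) * ?W"
    proof -
      have "C * m / (b - a) * l\<^sup>2 = l * C" 
        unfolding l(2)[symmetric] using l(1) m by (simp add: power2_eq_square)
      then have "ennreal (C * m / (b - a)) * ennreal (l\<^sup>2) = ennreal l * ennreal C"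
        using C m ab l by (simp flip: ennreal_mult)
      then show ?thesis unfolding W by (metis mult.assoc)
    qed
    finally show "\<exists>P\<in>vpoly r UNIV. pint p {a..<b} (\<lambda>t. f t - P t) \<le> ennreal (C * m / (b - a)) * ?W"
      using P by blast
  qed
qed

section \<open>Lebesgue measurable functions\<close>

text \<open>Each approximating simple function agrees almost everywhere with one measurable for
  \<open>M\<close>, and countably many null sets form a null set. Taking \<open>lim\<close> gives a
  measurable function even at points where the modified sequence diverges.\<close>

lemma completion_ex_borel_measurable_banach:
  fixes f :: "'b \<Rightarrow> 'a::{banach, second_countable_topology}"
  assumes "f \<in> borel_measurable (completion M)"
  shows "\<exists>g\<in>borel_measurable M. AE x in M. f x = g x"
proof -
  obtain s where s: "\<forall>i. simple_function (completion M) (s i)"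
      "\<forall>x\<in>space (completion M). (\<lambda>i. s i x) \<longlonglongrightarrow> f x"
    using borel_measurable_implies_sequence_metric[OF assms, of 0] by (elim exE conjE) (rule that)
  have "\<exists>s'. simple_function M s' \<and> (AE x in M. s i x = s' x)" for i
    by (rule completion_ex_simple_function) (rule s(1)[rule_format])
  then obtain s' where s': "\<And>i. simple_function M (s' i)" "\<And>i. AE x in M. s i x = s' i x" by metis
  have "(\<lambda>x. lim (\<lambda>i. s' i x)) \<in> borel_measurable M"
    using s'(1) by (intro borel_measurable_lim_metric borel_measurable_simple_function)
  moreover have "AE x in M. \<forall>i. s i x = s' i x" using s'(2) by (subst AE_all_countable) simp
  then have "AE x in M. f x = lim (\<lambda>i. s' i x)"
    using AE_space
  proof eventually_elim
    case (elim x)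
    then have "(\<lambda>i. s i x) = (\<lambda>i. s' i x)" "(\<lambda>i. s i x) \<longlonglongrightarrow> f x" using s(2) by auto
    then have "(\<lambda>i. s' i x) \<longlonglongrightarrow> f x" by simp
    then show ?case by (rule limI[symmetric])
  qed
  ultimately show ?thesis by (intro bexI[of _ "\<lambda>x. lim (\<lambda>i. s' i x)"])
qed

lemma lebesgue_on_ex_borel_measurable:
  fixes f :: "real \<Rightarrow> 'a::{banach, second_countable_topology}"
  assumes "f \<in> borel_measurable (lebesgue_on S)" "S \<in> sets borel"
  obtains g where "g \<in> borel_measurable borel" "AE t in lborel. t \<in> S \<longrightarrow> f t = g t"
proof -
  have "S \<inter> space lebesgue \<in> sets lebesgue" using assms(2) by (auto intro: sets_completionI_sets)
  then have "(\<lambda>t. if t \<in> S then f t else 0) \<in> borel_measurable lebesgue"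
    using assms(1) measurable_restrict_space_iff[of S lebesgue 0 borel f] by simp
  from completion_ex_borel_measurable_banach[OF this] obtain g
    where "g \<in> borel_measurable lborel" "AE t in lborel. (if t \<in> S then f t else 0) = g t" by blast
  moreover from this(2) have "AE t in lborel. t \<in> S \<longrightarrow> f t = g t" by (rule eventually_mono) auto
  ultimately show thesis using that[of g] by simp
qed

lemma AE_lebesgue_on_iff:
  assumes "S \<in> sets borel"
  shows "(AE t in lebesgue_on S. Q t) \<longleftrightarrow> (AE t in lborel. t \<in> S \<longrightarrow> Q t)"
proof -
  have "S \<inter> space lebesgue \<in> sets lebesgue" using assms by (auto intro: sets_completionI_sets)
  then show ?thesis by (simp add: AE_restrict_space_iff AE_completion_iff)
qed

lemma nn_integral_lebesgue_on:
  assumes "S \<in> sets borel"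
  shows "(\<integral>\<^sup>+ t. F t \<partial>lebesgue_on S) = (\<integral>\<^sup>+ t. F t * indicator S t \<partial>lborel)"
proof -
  have "S \<inter> space lebesgue \<in> sets lebesgue" using assms by (auto intro: sets_completionI_sets)
  then show ?thesis by (simp add: nn_integral_restrict_space nn_integral_completion)
qed

lemma AE_lborel_translate:
  fixes c :: "'b::euclidean_space"
  assumes "AE x in lborel. Q x"
  shows "AE x in lborel. Q (x + c)"
proof -
  obtain N where N: "{x \<in> space lborel. \<not> Q x} \<subseteq> N" "emeasure lborel N = 0" "N \<in> sets lborel"
    using AE_E[OF assms] by metis
  have [measurable]: "N \<in> sets borel" using N(3) by simp
  have "N \<in> null_sets lborel" using N(2,3) by (rule null_setsI)
  have "AE x in distr lborel borel ((+) c). x \<notin> N"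
    unfolding lborel_distr_plus by (rule AE_not_in) fact
  then have "AE x in lborel. c + x \<notin> N" by (subst (asm) AE_distr_iff) auto
  then show ?thesis by (rule eventually_mono) (use N(1) in \<open>auto simp: add.commute\<close>)
qed

section \<open>Quasi-norms and averaged moduli as integrals of powers\<close>

lemma ennpowr_inverse:
  assumes "0 < q"
  shows "ennpowr (ennpowr x (1 / q)) q = x"
proof (cases "x = \<infinity>")
  case True
  then show ?thesis by (simp add: ennpowr_def)
next
  case False
  then obtain y where y: "0 \<le> y" "x = ennreal y" by (cases x) auto
  then have "(y powr (1 / q)) powr q = y" using assms by (simp add: powr_powr)
  then show ?thesis unfolding y(2) ennpowr_ennreal[OF y(1)] ennpowr_ennreal[OF powr_ge_zero] by simp
qed

lemma ennpowr_less_top_iff: "ennpowr x s < \<infinity> \<longleftrightarrow> x < \<infinity>"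
proof (cases "x = \<infinity>")
  case True
  then show ?thesis by (simp add: ennpowr_def)
next
  case False
  then have "x < \<infinity>" by (simp add: less_top)
  then show ?thesis using False by (simp add: ennpowr_def)
qed

lemma Lp_norm_powr:
  assumes "p \<noteq> \<infinity>" "0 < p" and S: "S \<in> sets borel" and fg: "AE t in lborel. t \<in> S \<longrightarrow> f t = g t"
  shows "ennpowr (Lp_norm p S f) (enn2real p) = pint (enn2real p) S g"
proof -
  have "0 < enn2real p" using assms by (simp add: enn2real_positive_iff less_top)
  then have "ennpowr (Lp_norm p S f) (enn2real p) =
      (\<integral>\<^sup>+ t. ennreal (norm (f t) powr enn2real p) * indicator S t \<partial>lborel)"
    using assms(1) by (simp add: Lp_norm_def ennpowr_inverse nn_integral_lebesgue_on[OF S])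
  also have "\<dots> = pint (enn2real p) S g"
    unfolding pint_def
    by (rule nn_integral_cong_AE, rule eventually_mono[OF fg]) (auto simp: indicator_def)
  finally show ?thesis .
qed

lemma shrunk_interval: "0 \<le> s \<Longrightarrow> shrunk {a..<b} s = {y. a \<le> y \<and> y + s < b}"
  unfolding shrunk_def by auto

lemma shrunk_interval_sets: "shrunk {a..<b} s \<in> sets borel"
proof -
  have "shrunk {a..<b} s = {a..<b} \<inter> {a - s..<b - s}" unfolding shrunk_def by auto
  then show ?thesis by simp
qed

text \<open>There are finitely many nodes, so the exceptional set is a finite union of translates of
  one null set. It depends on \<open>h\<close>, which is harmless because \<open>h\<close> is fixed
  whenever the inner norm of a modulus is taken.\<close>

lemma AE_fdiff_cong:
  assumes fg: "AE t in lborel. t \<in> {a..<b} \<longrightarrow> f t = g t" and h: "0 < h"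
  shows "AE t in lborel. t \<in> shrunk {a..<b} (real r * h) \<longrightarrow> fdiff r h f t = fdiff r h g t"
proof -
  have "AE t in lborel. \<forall>i\<in>{..r}. t + real i * h \<in> {a..<b} \<longrightarrow> f (t + real i * h) = g (t + real i * h)"
    by (rule AE_finite_allI[OF finite_atMost]) (rule AE_lborel_translate[OF fg])
  then show ?thesis
  proof eventually_elim
    case (elim t)
    show ?case
    proof
      assume t: "t \<in> shrunk {a..<b} (real r * h)"
      have "f (t + real i * h) = g (t + real i * h)" if "i \<le> r" for i
      proof -
        have "0 \<le> real i * h" "real i * h \<le> real r * h" using h that by (auto intro: mult_right_mono)
        then have "t + real i * h \<in> {a..<b}" using t unfolding shrunk_def by auto
        then show ?thesis using elim that by auto
      qed
      then show "fdiff r h f t = fdiff r h g t" unfolding fdiff_def by simp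
    qed
  qed
qed

lemma avg_modulus_powr:
  fixes f g :: "real \<Rightarrow> 'a::{banach, second_countable_topology}"
  assumes p: "p \<noteq> \<infinity>" "0 < p" and g: "g \<in> borel_measurable borel"
    and fg: "AE t in lborel. t \<in> {a..<b} \<longrightarrow> f t = g t"
  shows "ennpowr (avg_modulus r f {a..<b} u p) (enn2real p) =
    inverse (ennreal u) * pint (enn2real p) (modulus_domain r a b u) (\<lambda>(y, v). fdiff r v g y)"
proof -
  have "0 < enn2real p" using p by (simp add: enn2real_positive_iff less_top)
  then have "ennpowr (avg_modulus r f {a..<b} u p) (enn2real p) = inverse (ennreal u) *
    (\<integral>\<^sup>+ h. ennpowr (Lp_norm p (shrunk {a..<b} (real r * h)) (fdiff r h f)) (enn2real p) * indicator {0<..u} h \<partial>lborel)"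
    using p(1) by (simp add: avg_modulus_def ennpowr_inverse nn_integral_lebesgue_on)
  also have "(\<integral>\<^sup>+ h. ennpowr (Lp_norm p (shrunk {a..<b} (real r * h)) (fdiff r h f)) (enn2real p) * indicator {0<..u} h \<partial>lborel)
    = (\<integral>\<^sup>+ h. pint (enn2real p) {y. a \<le> y \<and> y + real r * h < b} (fdiff r h g) * indicator {0<..u} h \<partial>lborel)"
  proof (rule nn_integral_cong)
    fix h
    show "ennpowr (Lp_norm p (shrunk {a..<b} (real r * h)) (fdiff r h f)) (enn2real p) * indicator {0<..u} h =
      pint (enn2real p) {y. a \<le> y \<and> y + real r * h < b} (fdiff r h g) * indicator {0<..u} h"
    proof (cases "h \<in> {0<..u}")
      case True
      then have "0 < h" by simp
      with Lp_norm_powr[OF p shrunk_interval_sets AE_fdiff_cong[OF fg this]] True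
      show ?thesis by (simp add: shrunk_interval)
    qed simp
  qed
  also have "\<dots> = pint (enn2real p) (modulus_domain r a b u) (\<lambda>(y, v). fdiff r v g y)"
    by (rule pint_modulus_domain[OF g, symmetric])
  finally show ?thesis .
qed

lemma vpoly_subset: "P \<in> vpoly r UNIV \<Longrightarrow> P \<in> vpoly r S"
  unfolding vpoly_def by auto

lemma whitney_finite_exponent:
  assumes p: "p \<noteq> \<infinity>" "0 < p" and r: "1 \<le> r"
  shows "\<exists>c>0. \<forall>a b. \<forall>f :: real \<Rightarrow> 'a::{banach, second_countable_topology}. a < b \<longrightarrow> f \<in> Lp_space p {a..<b} \<longrightarrow>
    (\<exists>P\<in>vpoly r {a..<b}. ennpowr (Lp_norm p {a..<b} (\<lambda>t. f t - P t)) (enn2real p)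
      \<le> ennreal c * ennpowr (avg_modulus r f {a..<b} ((b - a) / (2 * real r)) p) (enn2real p))"
proof -
  let ?q = "enn2real p"
  have q: "0 < ?q" using p by (simp add: enn2real_positive_iff less_top)
  define U where "U C \<longleftrightarrow> (\<forall>a b. \<forall>f :: real \<Rightarrow> 'a. a < b \<longrightarrow>
    f \<in> borel_measurable borel \<longrightarrow> pint ?q {a..<b} f < \<infinity> \<longrightarrow>
    (\<exists>P\<in>vpoly r UNIV. pint ?q {a..<b} (\<lambda>t. f t - P t) \<le>
      ennreal (C / (b - a)) * pint ?q (modulus_domain r a b ((b - a) / (2 * real r))) (\<lambda>(y, v). fdiff r v f y)))" for C
  have "\<exists>C\<ge>0. U C" unfolding U_def by (rule whitney_interval[OF q r])
  then obtain C where C: "0 \<le> C" "U C" by blast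
  \<comment> \<open>The averaged modulus divides by \<open>(b - a) / (2 r)\<close>, which turns
    \<open>C / (b - a)\<close> into \<open>C / (2 r)\<close>; the added 1 makes the constant
    positive.\<close>
  show ?thesis
  proof (intro exI[of _ "C / (2 * real r) + 1"] conjI allI impI)
    show "0 < C / (2 * real r) + 1" using C(1) by (simp add: add_nonneg_pos)
    fix a b :: real and f :: "real \<Rightarrow> 'a"
    assume ab: "a < b" and "f \<in> Lp_space p {a..<b}"
    then have f: "f \<in> borel_measurable (lebesgue_on {a..<b})" "Lp_norm p {a..<b} f < \<infinity>"
      unfolding Lp_space_def by auto
    obtain g where g: "g \<in> borel_measurable borel" and fg: "AE t in lborel. t \<in> {a..<b} \<longrightarrow> f t = g t"
      using lebesgue_on_ex_borel_measurable[OF f(1)] by auto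
    have "pint ?q {a..<b} g < \<infinity>"
      using f(2) Lp_norm_powr[OF p _ fg] ennpowr_less_top_iff[of "Lp_norm p {a..<b} f" ?q] by simp
    with C(2) g ab obtain P where P: "P \<in> vpoly r UNIV" "pint ?q {a..<b} (\<lambda>t. g t - P t) \<le>
      ennreal (C / (b - a)) * pint ?q (modulus_domain r a b ((b - a) / (2 * real r))) (\<lambda>(y, v). fdiff r v g y)"
      unfolding U_def by blast
    define u where "u = (b - a) / (2 * real r)"
    have u: "0 < u" using ab r unfolding u_def by simp
    have Cu: "C / (b - a) = C / (2 * real r) * inverse u"
      unfolding u_def using r by (simp add: field_simps)
    have "AE t in lborel. t \<in> {a..<b} \<longrightarrow> f t - P t = g t - P t" using fg by (rule eventually_mono) auto
    from Lp_norm_powr[OF p _ this] have "ennpowr (Lp_norm p {a..<b} (\<lambda>t. f t - P t)) ?q = pint ?q {a..<b} (\<lambda>t. g t - P t)"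
      by simp
    also have "\<dots> \<le> ennreal (C / (b - a)) * pint ?q (modulus_domain r a b u) (\<lambda>(y, v). fdiff r v g y)"
      using P(2) unfolding u_def .
    also have "\<dots> = ennreal (C / (2 * real r)) * ennpowr (avg_modulus r f {a..<b} u p) ?q"
    proof -
      have "ennreal (C / (b - a)) = ennreal (C / (2 * real r)) * inverse (ennreal u)"
        unfolding Cu using C(1) u by (subst ennreal_mult) (simp_all add: inverse_ennreal)
      then show ?thesis unfolding avg_modulus_powr[OF p g fg] by (simp only: mult.assoc)
    qed
    also have "\<dots> \<le> ennreal (C / (2 * real r) + 1) * ennpowr (avg_modulus r f {a..<b} u p) ?q"
      by (intro mult_right_mono ennreal_leI) auto
    finally show "\<exists>P\<in>vpoly r {a..<b}. ennpowr (Lp_norm p {a..<b} (\<lambda>t. f t - P t)) ?q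
      \<le> ennreal (C / (2 * real r) + 1) * ennpowr (avg_modulus r f {a..<b} ((b - a) / (2 * real r)) p) ?q"
      using vpoly_subset[OF P(1)] unfolding u_def by blast
  qed
qed

section \<open>The infinite exponent: pointwise bounds from integral bounds\<close>

lemma fdiff_minus: "fdiff r (- h) f t = (- 1) ^ r *\<^sub>R fdiff r h f (t - real r * h)"
proof (induction r arbitrary: t)
  case 0
  show ?case by (simp add: fdiff_def)
next
  case (Suc r)
  have "fdiff (Suc r) (- h) f t = fdiff r (- h) f (t - h) - fdiff r (- h) f t" by (simp add: fdiff_Suc)
  also have "\<dots> = (- 1) ^ Suc r *\<^sub>R (fdiff r h f (t - real r * h) - fdiff r h f (t - h - real r * h))"
    unfolding Suc.IH by (simp add: algebra_simps)
  also have "\<dots> = (- 1) ^ Suc r *\<^sub>R fdiff (Suc r) h f (t - real (Suc r) * h)"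
    unfolding fdiff_Suc[of r h f] by (simp add: algebra_simps)
  finally show ?case .
qed

lemma norm_le_norm_fdiff:
  fixes e :: "real \<Rightarrow> 'a::real_normed_vector"
  shows "norm (e t) \<le> norm (fdiff r k e t) + (\<Sum>i\<in>{1..r}. real (r choose i) * norm (e (t + real i * k)))"
proof -
  let ?T = "\<lambda>i. (real (r choose i) * (- 1) ^ (r - i)) *\<^sub>R e (t + real i * k)"
  have "{..r} = insert 0 {1..r}" by auto
  then have "fdiff r k e t = (- 1) ^ r *\<^sub>R e t + (\<Sum>i\<in>{1..r}. ?T i)"
    unfolding fdiff_def by simp
  then have "norm (e t) = norm (fdiff r k e t - (\<Sum>i\<in>{1..r}. ?T i))"
    by (simp add: power_abs)
  also have "\<dots> \<le> norm (fdiff r k e t) + norm (\<Sum>i\<in>{1..r}. ?T i)" by (rule norm_triangle_ineq4)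
  also have "norm (\<Sum>i\<in>{1..r}. ?T i) \<le> (\<Sum>i\<in>{1..r}. real (r choose i) * norm (e (t + real i * k)))"
    by (rule order_trans[OF norm_sum]) (simp add: power_abs abs_mult)
  finally show ?thesis by simp
qed

text \<open>Averaging over \<open>h\<close> replaces the values at the nodes with
  \<open>i \<ge> 1\<close> by integrals of \<open>norm e\<close>. The substitution at node
  \<open>i\<close> has Jacobian \<open>i \<ge> 1\<close>, so each costs at most the integral over
  the whole interval, and the binomial weights sum to at most \<open>2 ^ r\<close>.\<close>

lemma norm_le_average:
  fixes e :: "real \<Rightarrow> 'a::{real_normed_vector, second_countable_topology}"
  assumes e [measurable]: "e \<in> borel_measurable borel" and u: "0 < u" and M: "0 \<le> M"
    and \<sigma>: "\<bar>\<sigma>\<bar> = 1"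
    and le: "AE h in lborel. h \<in> {0<..u} \<longrightarrow> norm (fdiff r (\<sigma> * h) e t) \<le> M"
    and range: "\<And>h i. h \<in> {0<..u} \<Longrightarrow> i \<le> r \<Longrightarrow> t + real i * (\<sigma> * h) \<in> {a..<b}"
  shows "ennreal u * ennreal (norm (e t)) \<le> ennreal (u * M) + ennreal (2 ^ r) * pint 1 {a..<b} e"
proof -
  have node: "(\<integral>\<^sup>+ h. ennreal (norm (e (t + real i * (\<sigma> * h)))) * indicator {0<..u} h \<partial>lborel) \<le> pint 1 {a..<b} e"
    if i: "i \<in> {1..r}" for i
  proof -
    let ?c = "real i * \<sigma>"
    have abs_c: "\<bar>?c\<bar> = real i" using \<sigma> by (simp add: abs_mult)
    then have c: "?c \<noteq> 0" using i by auto
    let ?J = "\<integral>\<^sup>+ h. ennreal (norm (e (t + ?c * h))) * indicator {a..<b} (t + ?c * h) \<partial>lborel"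
    have "(\<integral>\<^sup>+ h. ennreal (norm (e (t + real i * (\<sigma> * h)))) * indicator {0<..u} h \<partial>lborel) \<le> ?J"
      using range i by (intro nn_integral_mono) (auto simp: indicator_def mult.assoc)
    also have "?J \<le> ennreal \<bar>?c\<bar> * ?J"
      unfolding abs_c using i mult_right_mono[of 1 "ennreal (real i)" ?J] by simp
    also have "\<dots> = pint 1 {a..<b} e"
      unfolding pint_def by (subst nn_integral_real_affine[OF _ c, of _ t]) auto
    finally show ?thesis .
  qed
  have "ennreal u * ennreal (norm (e t)) = (\<integral>\<^sup>+ h. ennreal (norm (e t)) * indicator {0<..u} h \<partial>lborel)"
    using u by (simp add: nn_integral_cmult mult.commute)
  also have "\<dots> \<le> (\<integral>\<^sup>+ h. ennreal M * indicator {0<..u} h +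
      (\<Sum>i\<in>{1..r}. ennreal (real (r choose i)) * (ennreal (norm (e (t + real i * (\<sigma> * h)))) * indicator {0<..u} h)) \<partial>lborel)"
  proof (rule nn_integral_mono_AE, use le in eventually_elim)
    case (elim h)
    show ?case
    proof (cases "h \<in> {0<..u}")
      case True
      have "norm (e t) \<le> M + (\<Sum>i\<in>{1..r}. real (r choose i) * norm (e (t + real i * (\<sigma> * h))))"
        using norm_le_norm_fdiff[of e t r "\<sigma> * h"] elim True by auto
      then have "ennreal (norm (e t)) \<le> ennreal (M + (\<Sum>i\<in>{1..r}. real (r choose i) * norm (e (t + real i * (\<sigma> * h)))))"
        by (rule ennreal_leI)
      also have "\<dots> = ennreal M + (\<Sum>i\<in>{1..r}. ennreal (real (r choose i)) * ennreal (norm (e (t + real i * (\<sigma> * h)))))"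
        using M by (simp add: ennreal_plus sum_nonneg ennreal_mult flip: sum_ennreal)
      finally show ?thesis using True by simp
    qed simp
  qed
  also have "\<dots> = ennreal M * ennreal u + (\<Sum>i\<in>{1..r}. ennreal (real (r choose i)) *
      (\<integral>\<^sup>+ h. ennreal (norm (e (t + real i * (\<sigma> * h)))) * indicator {0<..u} h \<partial>lborel))"
    using u by (simp add: nn_integral_add nn_integral_cmult nn_integral_sum)
  also have "\<dots> \<le> ennreal M * ennreal u + (\<Sum>i\<in>{1..r}. ennreal (real (r choose i)) * pint 1 {a..<b} e)"
    using node by (intro add_mono sum_mono mult_left_mono) auto
  also have "\<dots> \<le> ennreal (u * M) + ennreal (2 ^ r) * pint 1 {a..<b} e"
  proof (intro add_mono)
    have "(\<Sum>i\<in>{1..r}. r choose i) \<le> (\<Sum>i\<le>r. r choose i)" by (intro sum_mono2) auto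
    then have "real (\<Sum>i\<in>{1..r}. r choose i) \<le> real (2 ^ r)"
      unfolding choose_row_sum of_nat_le_iff .
    then have "(\<Sum>i\<in>{1..r}. real (r choose i)) \<le> 2 ^ r" by simp
    then show "(\<Sum>i\<in>{1..r}. ennreal (real (r choose i)) * pint 1 {a..<b} e) \<le> ennreal (2 ^ r) * pint 1 {a..<b} e"
      unfolding sum_distrib_right[symmetric]
      by (subst sum_ennreal) (auto intro!: mult_right_mono ennreal_leI)
  qed (use u M in \<open>simp add: ennreal_mult mult.commute\<close>)
  finally show ?thesis .
qed

text \<open>Points in the left half of the interval are compared with points further right, those in the
  right half with points further left.\<close>

lemma AE_norm_le_of_fdiff:
  fixes e :: "real \<Rightarrow> 'a::{real_normed_vector, second_countable_topology}"
  assumes e [measurable]: "e \<in> borel_measurable borel" and ab: "a < b" and r: "1 \<le> r" and M: "0 \<le> M"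
    and u: "u = (b - a) / (2 * real r)"
    and le: "\<And>h. h \<in> {0<..u} \<Longrightarrow> AE t in lborel. a \<le> t \<and> t + real r * h < b \<longrightarrow> norm (fdiff r h e t) \<le> M"
  shows "AE t in lborel. t \<in> {a..<b} \<longrightarrow>
    ennreal u * ennreal (norm (e t)) \<le> ennreal (u * M) + ennreal (2 ^ r) * pint 1 {a..<b} e"
proof -
  have u0: "0 < u" and ru: "real r * u = (b - a) / 2" using u ab r by auto
  \<comment> \<open>The hypothesis provides a null set of \<open>t\<close> for each
    \<open>h\<close>, whereas averaging over \<open>h\<close> needs a null set of \<open>h\<close>
    for almost every \<open>t\<close>. Fubini exchanges the two; the domain conditions are premises
    inside \<open>Q\<close> to obtain a measurable predicate on the whole plane.\<close>
  define Q where "Q \<sigma> t h \<longleftrightarrow> (h \<in> {0<..u} \<longrightarrow> t \<in> {a..<b} \<longrightarrow> t + real r * (\<sigma> * h) \<in> {a..<b} \<longrightarrow>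
    norm (fdiff r (\<sigma> * h) e t) \<le> M)" for \<sigma> t h :: real
  have commute: "AE t in lborel. AE h in lborel. Q \<sigma> t h" if "\<And>h. AE t in lborel. Q \<sigma> t h" for \<sigma>
  proof -
    have [measurable]: "(\<lambda>z. fdiff r (\<sigma> * snd z) e (fst z)) \<in> borel_measurable (borel \<Otimes>\<^sub>M borel)"
      unfolding fdiff_def by measurable
    have "Measurable.pred (borel \<Otimes>\<^sub>M borel) (\<lambda>z. Q \<sigma> (fst z) (snd z))"
      unfolding Q_def by measurable
    then have "{z \<in> space (lborel \<Otimes>\<^sub>M lborel). Q \<sigma> (fst z) (snd z)} \<in> sets (lborel \<Otimes>\<^sub>M lborel)"
      by (simp add: pred_def space_pair_measure cong: sets_pair_measure_cong)
    from lborel_pair.AE_commute[OF this] that show ?thesis by simp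
  qed
  have "AE t in lborel. AE h in lborel. Q 1 t h"
  proof (rule commute)
    fix h
    show "AE t in lborel. Q 1 t h"
    proof (cases "h \<in> {0<..u}")
      case True
      from le[OF this] show ?thesis by (rule eventually_mono) (auto simp: Q_def)
    next
      case False
      then have "Q 1 t h" for t unfolding Q_def by blast
      then show ?thesis by simp
    qed
  qed
  moreover have "AE t in lborel. AE h in lborel. Q (- 1) t h"
  proof (rule commute)
    fix h
    show "AE t in lborel. Q (- 1) t h"
    proof (cases "h \<in> {0<..u}")
      case True
      \<comment> \<open>Up to sign a backward difference at \<open>t\<close> is the forward
        difference at \<open>t - r h\<close>, so the null set is translated along.\<close>
      from AE_lborel_translate[OF le[OF this], of "- (real r * h)"] show ?thesis
        by (rule eventually_mono) (auto simp: Q_def fdiff_minus power_abs)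
    next
      case False
      then have "Q (- 1) t h" for t unfolding Q_def by blast
      then show ?thesis by simp
    qed
  qed
  ultimately show ?thesis
  proof eventually_elim
    case (elim t)
    show ?case
    proof
      assume t: "t \<in> {a..<b}"
      \<comment> \<open>As \<open>r * u\<close> is exactly half the length, no node leaves the
        interval in the chosen direction. The midpoint must go backwards: forwards its last node
        could hit the excluded end \<open>b\<close>.\<close>
      define \<sigma> :: real where "\<sigma> = (if t < (a + b) / 2 then 1 else - 1)"
      have \<sigma>: "\<bar>\<sigma>\<bar> = 1" unfolding \<sigma>_def by simp
      have range: "t + real i * (\<sigma> * h) \<in> {a..<b}" if h: "h \<in> {0<..u}" and i: "i \<le> r" for h i
      proof -
        have "0 \<le> real i * h" using h by simp
        moreover have "real i * h \<le> real r * u" using h i by (intro mult_mono) auto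
        ultimately show ?thesis using t unfolding \<sigma>_def ru by (auto simp: field_simps)
      qed
      have "AE h in lborel. Q \<sigma> t h" using elim unfolding \<sigma>_def by simp
      then have "AE h in lborel. h \<in> {0<..u} \<longrightarrow> norm (fdiff r (\<sigma> * h) e t) \<le> M"
        by (rule eventually_mono) (use t range in \<open>auto simp: Q_def\<close>)
      from norm_le_average[OF e u0 M \<sigma> this range]
      show "ennreal u * ennreal (norm (e t)) \<le> ennreal (u * M) + ennreal (2 ^ r) * pint 1 {a..<b} e" .
    qed
  qed
qed

lemma AE_le_Lp_norm_infinity:
  assumes "S \<in> sets borel"
  shows "AE t in lborel. t \<in> S \<longrightarrow> ennreal (norm (f t)) \<le> Lp_norm \<infinity> S f"
  using esssup_AE[of "\<lambda>t. ennreal (norm (f t))" "lebesgue_on S"]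
  unfolding AE_lebesgue_on_iff[OF assms] by (simp add: Lp_norm_def)

lemma whitney_infinite_exponent:
  assumes r: "1 \<le> r"
  shows "\<exists>c>0. \<forall>a b. \<forall>f :: real \<Rightarrow> 'a::{banach, second_countable_topology}. a < b \<longrightarrow> f \<in> Lp_space \<infinity> {a..<b} \<longrightarrow>
    (\<exists>P\<in>vpoly r {a..<b}. Lp_norm \<infinity> {a..<b} (\<lambda>t. f t - P t)
      \<le> ennreal c * avg_modulus r f {a..<b} ((b - a) / (2 * real r)) \<infinity>)"
proof -
  define U where "U C \<longleftrightarrow> (\<forall>a b. \<forall>f :: real \<Rightarrow> 'a. a < b \<longrightarrow>
    f \<in> borel_measurable borel \<longrightarrow> pint 1 {a..<b} f < \<infinity> \<longrightarrow>
    (\<exists>P\<in>vpoly r UNIV. pint 1 {a..<b} (\<lambda>t. f t - P t) \<le>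
      ennreal (C / (b - a)) * pint 1 (modulus_domain r a b ((b - a) / (2 * real r))) (\<lambda>(y, v). fdiff r v f y)))" for C
  have "\<exists>C\<ge>0. U C" unfolding U_def by (rule whitney_interval[OF _ r]) simp
  then obtain C where C: "0 \<le> C" "U C" by blast
  \<comment> \<open>With \<open>M\<close> the modulus, the differences are essentially bounded by
    \<open>M\<close> over a region of area at most \<open>(b - a) * u\<close>, so the error in the
    integral norm is at most \<open>C * M * u\<close>. Inserting this into
    \<open>u * norm e \<le> u * M + 2 ^ r * (C * M * u)\<close> and dividing by \<open>u\<close>
    gives \<open>c\<close>.\<close>
  define c where "c = 1 + 2 ^ r * C"
  have c: "0 < c" unfolding c_def using C(1) by (simp add: add_pos_nonneg)
  show ?thesis
  proof (intro exI[of _ c] conjI allI impI c)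
    fix a b :: real and f :: "real \<Rightarrow> 'a"
    assume ab: "a < b" and "f \<in> Lp_space \<infinity> {a..<b}"
    then have f: "f \<in> borel_measurable (lebesgue_on {a..<b})" "Lp_norm \<infinity> {a..<b} f < \<infinity>"
      unfolding Lp_space_def by auto
    define u where "u = (b - a) / (2 * real r)"
    have u: "0 < u" using ab r unfolding u_def by simp
    let ?N = "avg_modulus r f {a..<b} u \<infinity>"
    show "\<exists>P\<in>vpoly r {a..<b}. Lp_norm \<infinity> {a..<b} (\<lambda>t. f t - P t)
      \<le> ennreal c * avg_modulus r f {a..<b} ((b - a) / (2 * real r)) \<infinity>"
    proof (cases "?N = \<infinity>")
      case True
      then show ?thesis
        using c vpoly_subset[OF vpoly_zero] unfolding u_def by (intro bexI[of _ "\<lambda>_. 0"]) (auto simp: ennreal_mult_top)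
    next
      case False
      then obtain M where M: "?N = ennreal M" "0 \<le> M" by (cases ?N) auto
      obtain g where g [measurable]: "g \<in> borel_measurable borel" and fg: "AE t in lborel. t \<in> {a..<b} \<longrightarrow> f t = g t"
        using lebesgue_on_ex_borel_measurable[OF f(1)] by auto
      \<comment> \<open>Essential boundedness on an interval of finite length yields the finite
        integral that exponent 1 requires.\<close>
      have "AE t in lborel. t \<in> {a..<b} \<longrightarrow> ennreal (norm (f t)) \<le> Lp_norm \<infinity> {a..<b} f"
        by (rule AE_le_Lp_norm_infinity) simp
      with fg have "AE t in lborel. ennreal (norm (g t) powr 1) * indicator {a..<b} t \<le> Lp_norm \<infinity> {a..<b} f * indicator {a..<b} t"
        by eventually_elim (auto simp: indicator_def)
      then have "pint 1 {a..<b} g \<le> (\<integral>\<^sup>+ t. Lp_norm \<infinity> {a..<b} f * indicator {a..<b} t \<partial>lborel)"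
        unfolding pint_def by (rule nn_integral_mono_AE)
      also have "\<dots> < \<infinity>" using f(2) ab by (simp add: nn_integral_cmult ennreal_mult_less_top)
      finally have "pint 1 {a..<b} g < \<infinity>" .
      with C(2) g ab obtain P where P: "P \<in> vpoly r UNIV" "pint 1 {a..<b} (\<lambda>t. g t - P t) \<le>
        ennreal (C / (b - a)) * pint 1 (modulus_domain r a b u) (\<lambda>(y, v). fdiff r v g y)"
        unfolding U_def u_def by blast
      note P_meas [measurable] = vpoly_measurable[OF P(1)]
      have gM: "AE t in lborel. a \<le> t \<and> t + real r * h < b \<longrightarrow> norm (fdiff r h g t) \<le> M" if h: "h \<in> {0<..u}" for h
      proof -
        let ?S = "shrunk {a..<b} (real r * h)"
        have "Lp_norm \<infinity> ?S (fdiff r h f) \<le> ?N"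
          unfolding avg_modulus_def using h by (auto intro: SUP_upper)
        then have le: "x \<le> Lp_norm \<infinity> ?S (fdiff r h f) \<Longrightarrow> x \<le> ennreal M" for x
          unfolding M(1) by (rule order_trans[rotated])
        have "AE t in lborel. t \<in> ?S \<longrightarrow> ennreal (norm (fdiff r h f t)) \<le> Lp_norm \<infinity> ?S (fdiff r h f)"
          by (rule AE_le_Lp_norm_infinity[OF shrunk_interval_sets])
        moreover have "AE t in lborel. t \<in> ?S \<longrightarrow> fdiff r h f t = fdiff r h g t"
          using h by (intro AE_fdiff_cong fg) auto
        ultimately have "AE t in lborel. t \<in> ?S \<longrightarrow> ennreal (norm (fdiff r h g t)) \<le> ennreal M"
          by eventually_elim (use le in auto)
        then show ?thesis
          by (rule eventually_mono) (use h M(2) in \<open>auto simp: shrunk_interval ennreal_le_iff\<close>)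
      qed
      have "pint 1 (modulus_domain r a b u) (\<lambda>(y, v). fdiff r v g y) \<le>
        (\<integral>\<^sup>+ h. ennreal (M * (b - a)) * indicator {0<..u} h \<partial>lborel)"
        unfolding pint_modulus_domain[OF g]
      proof (rule nn_integral_mono)
        fix h
        show "pint 1 {y. a \<le> y \<and> y + real r * h < b} (fdiff r h g) * indicator {0<..u} h \<le>
          ennreal (M * (b - a)) * indicator {0<..u} h"
        proof (cases "h \<in> {0<..u}")
          case True
          have "pint 1 {y. a \<le> y \<and> y + real r * h < b} (fdiff r h g) \<le> (\<integral>\<^sup>+ y. ennreal M * indicator {a..<b} y \<partial>lborel)"
            unfolding pint_def
          proof (rule nn_integral_mono_AE, use gM[OF True] in eventually_elim)
            case (elim y)
            have "0 \<le> real r * h" using True by simp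
            then show ?case using elim by (auto simp: indicator_def ennreal_leI)
          qed
          also have "\<dots> = ennreal (M * (b - a))" using ab M(2) by (simp add: nn_integral_cmult ennreal_mult)
          finally show ?thesis using True by simp
        qed simp
      qed
      also have "\<dots> = ennreal (M * (b - a) * u)"
        using u ab M(2) by (simp add: nn_integral_cmult flip: ennreal_mult)
      finally have "pint 1 {a..<b} (\<lambda>t. g t - P t) \<le> ennreal (C / (b - a)) * ennreal (M * (b - a) * u)"
        using P(2) by (meson mult_left_mono order_trans zero_le)
      also have "\<dots> = ennreal (C * M * u)"
        using C(1) M(2) ab u by (subst ennreal_mult[symmetric]) simp_all
      finally have close: "pint 1 {a..<b} (\<lambda>t. g t - P t) \<le> ennreal (C * M * u)" .
      \<comment> \<open>Differences of order \<open>r\<close> do not see \<open>P\<close>, so the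
        bound \<open>M\<close> for \<open>g\<close> passes to the error
        \<open>g - P\<close>.\<close>
      have "fdiff r h (\<lambda>t. g t - P t) t = fdiff r h g t" for h t
        unfolding fdiff_diff using fdiff_vpoly[OF P(1)] by simp
      then have "AE t in lborel. t \<in> {a..<b} \<longrightarrow> ennreal u * ennreal (norm (g t - P t)) \<le>
        ennreal (u * M) + ennreal (2 ^ r) * pint 1 {a..<b} (\<lambda>t. g t - P t)"
        using gM by (intro AE_norm_le_of_fdiff ab r M(2) u_def) auto
      with fg have "AE t in lborel. t \<in> {a..<b} \<longrightarrow> ennreal (norm (f t - P t)) \<le> ennreal c * ?N"
      proof eventually_elim
        case (elim t)
        show ?case
        proof
          assume t: "t \<in> {a..<b}"
          then have "ennreal u * ennreal (norm (g t - P t)) \<le>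
            ennreal (u * M) + ennreal (2 ^ r) * pint 1 {a..<b} (\<lambda>t. g t - P t)" using elim by simp
          also have "\<dots> \<le> ennreal (u * M) + ennreal (2 ^ r) * ennreal (C * M * u)"
            using close by (intro add_left_mono mult_left_mono) auto
          also have "\<dots> = ennreal (u * (c * M))"
            unfolding c_def using u M(2) C(1)
            by (simp add: algebra_simps flip: ennreal_mult ennreal_plus)
          finally have "ennreal (u * norm (g t - P t)) \<le> ennreal (u * (c * M))"
            using u by (simp add: ennreal_mult)
          then have "norm (g t - P t) \<le> c * M" using u c M(2) by (simp add: ennreal_le_iff)
          then show "ennreal (norm (f t - P t)) \<le> ennreal c * ?N"
            using elim t c M by (simp add: ennreal_leI flip: ennreal_mult)
        qed
      qed
      then have "AE t in lebesgue_on {a..<b}. ennreal (norm (f t - P t)) \<le> ennreal c * ?N"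
        by (subst AE_lebesgue_on_iff) auto
      moreover have "P \<in> borel_measurable (lebesgue_on {a..<b})"
        using P_meas by (intro measurable_restrict_space1 measurable_completion) simp
      then have "(\<lambda>t. ennreal (norm (f t - P t))) \<in> borel_measurable (lebesgue_on {a..<b})"
        using f(1) by measurable
      ultimately have "Lp_norm \<infinity> {a..<b} (\<lambda>t. f t - P t) \<le> ennreal c * ?N"
        by (simp add: Lp_norm_def esssup_I)
      then show ?thesis using vpoly_subset[OF P(1)] unfolding u_def by blast
    qed
  qed
qed

theorem theorem9:
  fixes p :: ennreal and r :: nat
  assumes "0 < p" and "1 \<le> r"
  shows "\<exists>c::real. 0 < c \<and>
    (\<forall>(a::real) (b::real) (f :: real \<Rightarrow> 'a::{banach, second_countable_topology}).
      a < b \<longrightarrow> f \<in> Lp_space p {a..<b} \<longrightarrow>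
      (\<exists>P\<in>vpoly r {a..<b}.
        if p = \<infinity> then
          Lp_norm p {a..<b} (\<lambda>t. f t - P t)
            \<le> ennreal c * avg_modulus r f {a..<b} ((b - a) / (2 * real r)) p
        else
          ennpowr (Lp_norm p {a..<b} (\<lambda>t. f t - P t)) (enn2real p)
            \<le> ennreal c * ennpowr (avg_modulus r f {a..<b} ((b - a) / (2 * real r)) p) (enn2real p)))"
proof (cases "p = \<infinity>")
  case True
  show ?thesis using whitney_infinite_exponent[OF assms(2), where 'a = 'a] unfolding True by (simp only: if_True simp_thms)
next
  case False
  show ?thesis using whitney_finite_exponent[OF False assms, where 'a = 'a] False by (simp only: if_False simp_thms)
qed

end
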